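(* Let $(G,K,\Gamma,\mathcal{H})$ be an algebraic Anosov action such that $K$ is connected and centralizes $\mathcal{H}$. Let $\mathcal{K}=\mathcal{K}^*\oplus\mathcal{T}_1$ be a Levi decomposition of the Lie algebra $\mathcal{K}$ of $K$ ($\mathcal{K}^*$ semisimple, $\mathcal{T}_1$ the radical), and let $\mathfrak{a}_0$ be a maximal abelian subalgebra of $\mathcal{K}^*$. Then $\mathcal{H}\oplus\mathfrak{a}_0\oplus\mathcal{T}_1$ is a Cartan subalgebra of the Lie algebra $\mathcal{G}$ of $G$.
   Context: An algebraic action is a quadruple $(G,K,\Gamma,\mathcal{H})$ where $G$ is a connected Lie group with Lie algebra $\mathcal{G}$; $K$ is a compact subgroup of $G$ with Lie algebra $\mathcal{K}$; $\mathcal{H}$ is a nilpotent Lie subalgebra of $\mathcal{G}$ contained in the normalizer of $\mathcal{K}$ with $\mathcal{H}\cap\mathcal{K}=\{0\}$; $\Gamma$ is a uniform lattice in $G$ acting freely on $G/K$. Let $H$ be the simply connected Lie group with Lie algebra $\mathcal{H}$; viewing elements of $\mathcal{H}$ as left-invariant vector fields one gets a locally free right action of $H$ on the closed manifold $\Gamma\backslash G/K$. The algebraic action is Anosov if this $H$-action is Anosov; equivalently, there are $\mathfrak{h}_0\in\mathcal{H}$ and an $\mathrm{ad}(\mathfrak{h}_0)$-invariant splitting $\mathcal{G}=\mathcal{U}\oplus\mathcal{S}\oplus\mathcal{K}\oplus\mathcal{H}$ such that the eigenvalues of $\mathrm{ad}\,\mathfrak{h}_0$ on $\mathcal{U}$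 (resp. $\mathcal{S}$) have positive (resp. negative) real part. A Cartan subalgebra (CSA) of a real Lie algebra is a nilpotent subalgebra equal to its own normalizer. *)

theory Defs
  imports "HOL-Analysis.Analysis" "HOL-Algebra.Coset" "HOL-Library.Function_Algebras"
begin

section \<open>Functions as a real vector space\<close>

text \<open>The Lie algebra of a Lie group is realised below as a subspace of the operators on
  real-valued functions, with the pointwise vector space structure.\<close>

instantiation "fun" :: (type, scaleR) scaleR
begin

definition "scaleR r f = (\<lambda>x. r *\<^sub>R f x)"

instance ..

end

lemma scaleR_fun_apply [simp]: "(r *\<^sub>R f) x = r *\<^sub>R f x"
  by (simp add: scaleR_fun_def)

instance "fun" :: (type, real_vector) real_vector
  by standard (simp_all add: fun_eq_iff scaleR_add_right scaleR_add_left)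


section \<open>Real Lie algebras\<close>

text \<open>Throughout this section \<open>br\<close> is the bracket of the ambient Lie algebra;
  subalgebras and ideals are sets of vectors.\<close>

definition bracket_span :: "('v \<Rightarrow> 'v \<Rightarrow> 'v) \<Rightarrow> 'v set \<Rightarrow> 'v set \<Rightarrow> 'v::real_vector set" where
  "bracket_span br M N = span {br x y | x y. x \<in> M \<and> y \<in> N}"

definition lie_subalgebra :: "('v \<Rightarrow> 'v \<Rightarrow> 'v) \<Rightarrow> 'v::real_vector set \<Rightarrow> 'v set \<Rightarrow> bool" where
  "lie_subalgebra br L M \<longleftrightarrow>
     subspace M \<and> M \<subseteq> L \<and> (\<forall>x\<in>M. \<forall>y\<in>M. br x y \<in> M)"

definition lie_ideal :: "('v \<Rightarrow> 'v \<Rightarrow> 'v) \<Rightarrow> 'v::real_vector set \<Rightarrow> 'v set \<Rightarrow> bool" where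
  "lie_ideal br L I \<longleftrightarrow>
     subspace I \<and> I \<subseteq> L \<and> (\<forall>x\<in>L. \<forall>y\<in>I. br x y \<in> I)"

definition lie_normalizer :: "('v \<Rightarrow> 'v \<Rightarrow> 'v) \<Rightarrow> 'v set \<Rightarrow> 'v set \<Rightarrow> 'v set" where
  "lie_normalizer br L M = {x \<in> L. \<forall>y\<in>M. br x y \<in> M}"

fun lower_central :: "('v \<Rightarrow> 'v \<Rightarrow> 'v) \<Rightarrow> 'v::real_vector set \<Rightarrow> nat \<Rightarrow> 'v set" where
  "lower_central br M 0 = M"
| "lower_central br M (Suc n) = bracket_span br M (lower_central br M n)"

fun derived_series :: "('v \<Rightarrow> 'v \<Rightarrow> 'v) \<Rightarrow> 'v::real_vector set \<Rightarrow> nat \<Rightarrow> 'v set" where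
  "derived_series br M 0 = M"
| "derived_series br M (Suc n) = bracket_span br (derived_series br M n) (derived_series br M n)"

definition lie_nilpotent :: "('v \<Rightarrow> 'v \<Rightarrow> 'v) \<Rightarrow> 'v::real_vector set \<Rightarrow> bool" where
  "lie_nilpotent br M \<longleftrightarrow> (\<exists>n. lower_central br M n = {0})"

definition lie_solvable :: "('v \<Rightarrow> 'v \<Rightarrow> 'v) \<Rightarrow> 'v::real_vector set \<Rightarrow> bool" where
  "lie_solvable br M \<longleftrightarrow> (\<exists>n. derived_series br M n = {0})"

definition is_radical :: "('v \<Rightarrow> 'v \<Rightarrow> 'v) \<Rightarrow> 'v::real_vector set \<Rightarrow> 'v set \<Rightarrow> bool" where
  "is_radical br L R \<longleftrightarrow>
     lie_ideal br L R \<and> lie_solvable br R \<and>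
     (\<forall>I. lie_ideal br L I \<and> lie_solvable br I \<longrightarrow> I \<subseteq> R)"

definition lie_semisimple :: "('v \<Rightarrow> 'v \<Rightarrow> 'v) \<Rightarrow> 'v::real_vector set \<Rightarrow> bool" where
  "lie_semisimple br L \<longleftrightarrow> is_radical br L {0}"

definition abelian_subalgebra :: "('v \<Rightarrow> 'v \<Rightarrow> 'v) \<Rightarrow> 'v::real_vector set \<Rightarrow> 'v set \<Rightarrow> bool" where
  "abelian_subalgebra br L M \<longleftrightarrow>
     lie_subalgebra br L M \<and> (\<forall>x\<in>M. \<forall>y\<in>M. br x y = 0)"

definition maximal_abelian_subalgebra ::
    "('v \<Rightarrow> 'v \<Rightarrow> 'v) \<Rightarrow> 'v::real_vector set \<Rightarrow> 'v set \<Rightarrow> bool" where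
  "maximal_abelian_subalgebra br L M \<longleftrightarrow>
     abelian_subalgebra br L M \<and>
     (\<forall>N. abelian_subalgebra br L N \<and> M \<subseteq> N \<longrightarrow> N = M)"

definition cartan_subalgebra :: "('v \<Rightarrow> 'v \<Rightarrow> 'v) \<Rightarrow> 'v::real_vector set \<Rightarrow> 'v set \<Rightarrow> bool" where
  "cartan_subalgebra br L C \<longleftrightarrow>
     lie_subalgebra br L C \<and> lie_nilpotent br C \<and> lie_normalizer br L C = C"

text \<open>\<open>direct_sum [V1, ..., Vn] W\<close>: every element of \<open>W\<close> is \<open>v1 + ... + vn\<close> for a
  unique choice of \<open>vi \<in> Vi\<close>, and all these sums lie in \<open>W\<close>.\<close>

definition direct_sum :: "'v::real_vector set list \<Rightarrow> 'v set \<Rightarrow> bool" where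
  "direct_sum Vs W \<longleftrightarrow> (\<forall>V\<in>set Vs. subspace V) \<and> bij_betw sum_list (listset Vs) W"

definition levi_decomposition ::
    "('v \<Rightarrow> 'v \<Rightarrow> 'v) \<Rightarrow> 'v::real_vector set \<Rightarrow> 'v set \<Rightarrow> 'v set \<Rightarrow> bool" where
  "levi_decomposition br L M R \<longleftrightarrow>
     lie_subalgebra br L M \<and> lie_semisimple br M \<and> is_radical br L R \<and> direct_sum [M, R] L"

text \<open>\<open>z\<close> is an eigenvalue of the complexification of \<open>T\<close> restricted to \<open>V\<close>: the two equations
  are the real and imaginary parts of \<open>T (v + i w) = z (v + i w)\<close>.\<close>

definition complex_eigenvalue_on ::
    "'v::real_vector set \<Rightarrow> ('v \<Rightarrow> 'v) \<Rightarrow> complex \<Rightarrow> bool" where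
  "complex_eigenvalue_on V T z \<longleftrightarrow>
     (\<exists>v\<in>V. \<exists>w\<in>V. \<not> (v = 0 \<and> w = 0) \<and>
        T v = Re z *\<^sub>R v - Im z *\<^sub>R w \<and> T w = Im z *\<^sub>R v + Re z *\<^sub>R w)"


section \<open>Lie groups\<close>

text \<open>Smoothness on open subsets of finite-dimensional normed spaces.\<close>

fun Ck_on :: "nat \<Rightarrow> 'a::real_normed_vector set \<Rightarrow> ('a \<Rightarrow> 'b::real_normed_vector) \<Rightarrow> bool" where
  "Ck_on 0 S f \<longleftrightarrow> continuous_on S f"
| "Ck_on (Suc k) S f \<longleftrightarrow>
     (\<forall>x\<in>S. f differentiable (at x)) \<and>
     (\<forall>v. Ck_on k S (\<lambda>x. frechet_derivative f (at x) v))"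

definition smooth_on :: "'a::real_normed_vector set \<Rightarrow> ('a \<Rightarrow> 'b::real_normed_vector) \<Rightarrow> bool" where
  "smooth_on S f \<longleftrightarrow> (\<forall>k. Ck_on k S f)"

text \<open>A chart is a pair of its domain and its coordinate map (relevant only on the domain).\<close>

type_synonym ('g, 'e) chart = "'g set \<times> ('g \<Rightarrow> 'e)"

abbreviation chart_inv :: "('g, 'e) chart \<Rightarrow> 'e \<Rightarrow> 'g" where
  "chart_inv C \<equiv> inv_into (fst C) (snd C)"

abbreviation chart_img :: "('g, 'e) chart \<Rightarrow> 'e set" where
  "chart_img C \<equiv> snd C ` fst C"

text \<open>The model space \<open>'e\<close> is only required to be a finite-dimensional inner product space
  (rather than of class \<open>euclidean_space\<close>) so that dimension 0 is included.\<close>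

definition smooth_atlas ::
    "('g::topological_space, 'e::real_inner) chart set \<Rightarrow> bool" where
  "smooth_atlas A \<longleftrightarrow>
     (\<exists>B::'e set. finite B \<and> span B = UNIV) \<and>
     (\<Union>C\<in>A. fst C) = UNIV \<and>
     (\<forall>C\<in>A. open (fst C) \<and> open (chart_img C) \<and>
        homeomorphism (fst C) (chart_img C) (snd C) (chart_inv C)) \<and>
     (\<forall>C\<in>A. \<forall>D\<in>A. smooth_on (snd C ` (fst C \<inter> fst D)) (\<lambda>x. snd D (chart_inv C x)))"

locale lie_group = group G
  for G :: "'g::{t2_space, second_countable_topology} monoid" (structure) +
  fixes A :: "('g, 'e::real_inner) chart set"
  assumes carrier_UNIV: "carrier G = UNIV"
    and atlas: "smooth_atlas A"
    and continuous_mult: "continuous_on UNIV (\<lambda>p. fst p \<otimes> snd p)"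
    and continuous_inv: "continuous_on UNIV (\<lambda>x. inv x)"
    and smooth_mult: "\<lbrakk>C \<in> A; D \<in> A; E \<in> A\<rbrakk> \<Longrightarrow>
      smooth_on {p \<in> chart_img C \<times> chart_img D.
                   chart_inv C (fst p) \<otimes> chart_inv D (snd p) \<in> fst E}
        (\<lambda>p. snd E (chart_inv C (fst p) \<otimes> chart_inv D (snd p)))"
    and smooth_inv: "\<lbrakk>C \<in> A; E \<in> A\<rbrakk> \<Longrightarrow>
      smooth_on {x \<in> chart_img C. inv (chart_inv C x) \<in> fst E} (\<lambda>x. snd E (inv (chart_inv C x)))"

definition smooth_functions ::
    "('g::topological_space, 'e::real_inner) chart set \<Rightarrow> ('g \<Rightarrow> real) set" where
  "smooth_functions A = {f. \<forall>C\<in>A. smooth_on (chart_img C) (\<lambda>x. f (chart_inv C x))}"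

text \<open>Vector fields are derivations of the algebra of smooth functions. The Lie algebra consists of
  the left-invariant ones; setting a derivation to 0 off the smooth functions makes
  equality and the vector space operations the intended ones.\<close>

definition derivation_field ::
    "('g::topological_space, 'e::real_inner) chart set \<Rightarrow> (('g \<Rightarrow> real) \<Rightarrow> 'g \<Rightarrow> real) \<Rightarrow> bool" where
  "derivation_field A X \<longleftrightarrow>
     (\<forall>f. f \<notin> smooth_functions A \<longrightarrow> X f = 0) \<and>
     (\<forall>f\<in>smooth_functions A. X f \<in> smooth_functions A) \<and>
     (\<forall>f\<in>smooth_functions A. \<forall>g\<in>smooth_functions A. X (f + g) = X f + X g) \<and>
     (\<forall>f\<in>smooth_functions A. \<forall>r. X (r *\<^sub>R f) = r *\<^sub>R X f) \<and>
     (\<forall>f\<in>smooth_functions A. \<forall>g\<in>smooth_functions A. X (f * g) = X f * g + f * X g)"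

definition lie_algebra ::
    "'g::topological_space monoid \<Rightarrow> ('g, 'e::real_inner) chart set \<Rightarrow>
     (('g \<Rightarrow> real) \<Rightarrow> 'g \<Rightarrow> real) set" where
  "lie_algebra G A =
     {X. derivation_field A X \<and>
         (\<forall>a. \<forall>f\<in>smooth_functions A. X (\<lambda>x. f (a \<otimes>\<^bsub>G\<^esub> x)) = (\<lambda>x. X f (a \<otimes>\<^bsub>G\<^esub> x)))}"

definition field_bracket ::
    "(('g \<Rightarrow> real) \<Rightarrow> 'g \<Rightarrow> real) \<Rightarrow> (('g \<Rightarrow> real) \<Rightarrow> 'g \<Rightarrow> real) \<Rightarrow> ('g \<Rightarrow> real) \<Rightarrow> 'g \<Rightarrow> real" where
  "field_bracket X Y = (\<lambda>f. X (Y f) - Y (X f))"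

text \<open>\<open>\<phi>\<close> is the one-parameter subgroup \<open>t \<mapsto> exp (t X)\<close>.\<close>

definition one_parameter_subgroup ::
    "'g::topological_space monoid \<Rightarrow> ('g, 'e::real_inner) chart set \<Rightarrow>
     (('g \<Rightarrow> real) \<Rightarrow> 'g \<Rightarrow> real) \<Rightarrow> (real \<Rightarrow> 'g) \<Rightarrow> bool" where
  "one_parameter_subgroup G A X \<phi> \<longleftrightarrow>
     continuous_on UNIV \<phi> \<and>
     (\<forall>C\<in>A. smooth_on (\<phi> -` fst C) (\<lambda>t. snd C (\<phi> t))) \<and>
     (\<forall>s t. \<phi> (s + t) = \<phi> s \<otimes>\<^bsub>G\<^esub> \<phi> t) \<and>
     (\<forall>f\<in>smooth_functions A. \<forall>t. ((\<lambda>s. f (\<phi> s)) has_real_derivative X f (\<phi> t)) (at t))"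

text \<open>The Lie algebra of a closed subgroup, as a subalgebra of that of the ambient group.\<close>

definition subgroup_lie_algebra ::
    "'g::topological_space monoid \<Rightarrow> ('g, 'e::real_inner) chart set \<Rightarrow> 'g set \<Rightarrow>
     (('g \<Rightarrow> real) \<Rightarrow> 'g \<Rightarrow> real) set" where
  "subgroup_lie_algebra G A K =
     {X \<in> lie_algebra G A. \<exists>\<phi>. one_parameter_subgroup G A X \<phi> \<and> range \<phi> \<subseteq> K}"

text \<open>For left-invariant \<open>X\<close>, the push-forward of \<open>X\<close> under the conjugation
  \<open>c x = k x k\<inverse>\<close>, i.e. \<open>f \<mapsto> X (f \<circ> c) \<circ> c\<inverse>\<close>.\<close>

definition Ad ::
    "'g monoid \<Rightarrow> 'g \<Rightarrow> (('g \<Rightarrow> real) \<Rightarrow> 'g \<Rightarrow> real) \<Rightarrow> ('g \<Rightarrow> real) \<Rightarrow> 'g \<Rightarrow> real" where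
  "Ad G k X = (\<lambda>f x. X (\<lambda>y. f (k \<otimes>\<^bsub>G\<^esub> y \<otimes>\<^bsub>G\<^esub> inv\<^bsub>G\<^esub> k)) (inv\<^bsub>G\<^esub> k \<otimes>\<^bsub>G\<^esub> x \<otimes>\<^bsub>G\<^esub> k))"

definition centralizes ::
    "'g monoid \<Rightarrow> 'g set \<Rightarrow> (('g \<Rightarrow> real) \<Rightarrow> 'g \<Rightarrow> real) set \<Rightarrow> bool" where
  "centralizes G K M \<longleftrightarrow> (\<forall>k\<in>K. \<forall>X\<in>M. Ad G k X = X)"


section \<open>Algebraic Anosov actions\<close>

text \<open>A discrete subgroup \<open>\<Gamma>\<close> such that the space of cosets \<open>\<Gamma> g\<close>, with the quotient topology, is
  compact; the quotient map determines that topology.\<close>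

definition uniform_lattice :: "'g::topological_space monoid \<Rightarrow> 'g set \<Rightarrow> bool" where
  "uniform_lattice G \<Gamma> \<longleftrightarrow>
     subgroup \<Gamma> G \<and> discrete \<Gamma> \<and>
     (\<exists>Q. quotient_map euclidean Q (\<lambda>g. \<Gamma> #>\<^bsub>G\<^esub> g) \<and> compact_space Q)"

definition acts_freely_on_cosets :: "'g monoid \<Rightarrow> 'g set \<Rightarrow> 'g set \<Rightarrow> bool" where
  "acts_freely_on_cosets G \<Gamma> K \<longleftrightarrow>
     (\<forall>\<gamma>\<in>\<Gamma>. \<forall>g\<in>carrier G. (\<gamma> \<otimes>\<^bsub>G\<^esub> g) <#\<^bsub>G\<^esub> K = g <#\<^bsub>G\<^esub> K \<longrightarrow> \<gamma> = \<one>\<^bsub>G\<^esub>)"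

definition algebraic_action ::
    "'g::{t2_space, second_countable_topology} monoid \<Rightarrow> ('g, 'e::real_inner) chart set \<Rightarrow>
     'g set \<Rightarrow> 'g set \<Rightarrow> (('g \<Rightarrow> real) \<Rightarrow> 'g \<Rightarrow> real) set \<Rightarrow> bool" where
  "algebraic_action G A K \<Gamma> H \<longleftrightarrow>
     lie_group G A \<and> connected (UNIV :: 'g set) \<and>
     subgroup K G \<and> compact K \<and>
     lie_subalgebra field_bracket (lie_algebra G A) H \<and> lie_nilpotent field_bracket H \<and>
     H \<subseteq> lie_normalizer field_bracket (lie_algebra G A) (subgroup_lie_algebra G A K) \<and>
     H \<inter> subgroup_lie_algebra G A K = {0} \<and>
     uniform_lattice G \<Gamma> \<and> acts_freely_on_cosets G \<Gamma> K"

text \<open>The Anosov property of the induced action on the double quotient \<open>\<Gamma>\G/K\<close>, in terms of a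
  hyperbolic splitting of the Lie algebra.\<close>

definition algebraic_anosov_action ::
    "'g::{t2_space, second_countable_topology} monoid \<Rightarrow> ('g, 'e::real_inner) chart set \<Rightarrow>
     'g set \<Rightarrow> 'g set \<Rightarrow> (('g \<Rightarrow> real) \<Rightarrow> 'g \<Rightarrow> real) set \<Rightarrow> bool" where
  "algebraic_anosov_action G A K \<Gamma> H \<longleftrightarrow>
     algebraic_action G A K \<Gamma> H \<and>
     (\<exists>h0\<in>H. \<exists>U S.
        direct_sum [U, S, subgroup_lie_algebra G A K, H] (lie_algebra G A) \<and>
        (\<forall>V\<in>{U, S, subgroup_lie_algebra G A K, H}. field_bracket h0 ` V \<subseteq> V) \<and>
        (\<forall>z. complex_eigenvalue_on U (field_bracket h0) z \<longrightarrow> Re z > 0) \<and>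
        (\<forall>z. complex_eigenvalue_on S (field_bracket h0) z \<longrightarrow> Re z < 0))"

end

theory Submission
  imports Defs
begin

text \<open>A left-invariant derivation is a directional derivative at the identity, by Hadamard's lemma.
  Hence, with \<open>\<phi>\<close> the one-parameter subgroup of \<open>Y\<close>, the curve \<open>t \<mapsto> Ad (\<phi> t) X\<close> has derivative
  \<open>t \<mapsto> Ad (\<phi> t) [Y, X]\<close>. For \<open>Y\<close> in the Lie algebra \<open>\<K>\<close> of \<open>K\<close> this has two consequences.
  First, \<open>[Y, X] = 0\<close> for \<open>X\<close> in \<open>H\<close>, because \<open>K\<close> centralizes \<open>H\<close>. Second, if \<open>[Y, [Y, X]] = 0\<close>, then
  \<open>Ad (\<phi> t) X = X + t [Y, X]\<close>, which is bounded since \<open>K\<close> is compact, so \<open>[Y, X] = 0\<close>.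
  The second fact makes solvable ideals of \<open>\<K>\<close> central and \<open>a0\<close> self-normalizing in \<open>Kstar\<close>.
  An element normalizing \<open>H + a0 + T1\<close> has no component in the stable and unstable spaces, because
  \<open>ad h0\<close> is injective there.\<close>

section \<open>Calculus of smooth functions\<close>

text \<open>An element of the Lie algebra is an operator on globally defined smooth functions, and
  its definition does not say that it can be exchanged with differentiation in a parameter. This is
  the obstacle to differentiating \<open>Ad (\<phi> t) X\<close>, where \<open>X\<close> acts on
  functions that themselves vary with \<open>t\<close>. Once \<open>X\<close> is differentiation at
  the identity in one fixed direction \<open>a\<close>, all these values are partial derivatives of
  a single function, jointly smooth because the multiplication is smooth, and the exchange becomes
  the symmetry of second derivatives. Hadamard's lemma yields its factors only on a ball in a chart,
  whereas a derivation accepts only functions on the whole group; a bump function, flat at the edge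
  of its support, bridges this gap.\<close>

lemma finite_orthonormal_expansion:
  fixes B0 :: "'a::real_inner set"
  assumes "finite B0" "span B0 = UNIV"
  obtains B :: "'a set" where "finite B" "\<And>x. (\<Sum>b\<in>B. (x \<bullet> b) *\<^sub>R b) = x"
proof -
  obtain C :: "'a set" where C: "finite C" "span C = UNIV" "pairwise orthogonal C"
    using basis_orthogonal[OF assms(1)] assms(2) by auto
  \<comment> \<open>The orthogonal set \<open>C\<close> may contain 0, which is dropped before
    normalizing. In dimension 0 this leaves \<open>B\<close> empty.\<close>
  define B where "B = (\<lambda>c. c /\<^sub>R norm c) ` (C - {0})"
  have fB: "finite B" using C by (simp add: B_def)
  have orth: "b \<bullet> c = (if b = c then 1 else 0)" if bc: "b \<in> B" "c \<in> B" for b c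
  proof -
    obtain b' c' where *: "b' \<in> C" "c' \<in> C" "b' \<noteq> 0" "c' \<noteq> 0"
      "b = b' /\<^sub>R norm b'" "c = c' /\<^sub>R norm c'"
      using bc unfolding B_def by auto
    show ?thesis
    proof (cases "b' = c'")
      case True
      then show ?thesis using * by (simp add: dot_square_norm power2_eq_square)
    next
      case False
      then have "b' \<bullet> c' = 0" using C(3) * by (auto simp: pairwise_def orthogonal_def)
      then have "b \<bullet> c = 0" using * by simp
      moreover have "c \<bullet> c \<noteq> 0" using * by simp
      ultimately show ?thesis by auto
    qed
  qed
  have "C \<subseteq> span B"
  proof
    fix c assume c: "c \<in> C"
    show "c \<in> span B"
    proof (cases "c = 0")
      case False
      then have "c /\<^sub>R norm c \<in> span B" using c by (auto simp: B_def intro!: span_base)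
      then have "norm c *\<^sub>R (c /\<^sub>R norm c) \<in> span B" by (rule span_scale)
      then show ?thesis using False by simp
    qed (simp add: span_zero)
  qed
  then have "span B = UNIV" using C(2) span_minimal[OF _ subspace_span] by blast
  then have "(\<Sum>b\<in>B. (x \<bullet> b) *\<^sub>R b) = x" for x
  proof -
    have "x \<in> span B" using \<open>span B = UNIV\<close> by simp
    then obtain u where u: "x = (\<Sum>b\<in>B. u b *\<^sub>R b)"
      using span_finite[OF fB] by auto
    have "x \<bullet> b = u b" if "b \<in> B" for b
    proof -
      have "x \<bullet> b = (\<Sum>c\<in>B. u c * (c \<bullet> b))" by (simp add: u inner_sum_left)
      also have "\<dots> = (\<Sum>c\<in>B. if c = b then u c else 0)"
        by (intro sum.cong refl) (use orth that in auto)
      finally show ?thesis using that fB by simp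
    qed
    then show ?thesis using u by simp
  qed
  with fB show ?thesis using that by blast
qed

text \<open>A predicate on types rather than the class \<open>euclidean_space\<close>, so that
  dimension 0 is covered; it passes to the products that serve as parameter spaces below.\<close>

definition finite_dimensional :: "'a::real_normed_vector itself \<Rightarrow> bool" where
  "finite_dimensional (_ :: 'a itself) \<longleftrightarrow> (\<exists>B::'a set. finite B \<and> span B = UNIV)"

lemma finite_dimensional_real: "finite_dimensional TYPE(real)"
proof -
  have "x \<in> span {1::real}" for x
    using span_scale[OF span_base[of "1::real" "{1}"], of x] by simp
  then show ?thesis unfolding finite_dimensional_def by (intro exI[of _ "{1}"]) auto
qed

lemma finite_dimensional_prod:
  assumes "finite_dimensional TYPE('a::real_normed_vector)"
    "finite_dimensional TYPE('b::real_normed_vector)"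
  shows "finite_dimensional TYPE('a \<times> 'b)"
proof -
  obtain B :: "'a set" where B: "finite B" "span B = UNIV" using assms by (auto simp: finite_dimensional_def)
  obtain C :: "'b set" where C: "finite C" "span C = UNIV" using assms by (auto simp: finite_dimensional_def)
  let ?D = "(\<lambda>b. (b, 0)) ` B \<union> (\<lambda>c. (0, c)) ` C"
  have l: "linear (\<lambda>b::'a. (b, 0::'b))" "linear (\<lambda>c::'b. (0::'a, c))"
    by (auto intro!: linearI)
  have "(x, y) \<in> span ?D" for x y
  proof -
    have "(x, 0) \<in> span ((\<lambda>b. (b, 0::'b)) ` B)" "(0, y) \<in> span ((\<lambda>c. (0::'a, c)) ` C)"
      using B C by (auto simp: linear_span_image[OF l(1)] linear_span_image[OF l(2)])
    then have "(x, 0) \<in> span ?D" "(0, y) \<in> span ?D"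
      by (meson Un_upper1 Un_upper2 in_mono span_mono)+
    from span_add[OF this] show ?thesis by simp
  qed
  then show ?thesis unfolding finite_dimensional_def
    by (intro exI[of _ ?D]) (use B C in auto)
qed

section \<open>Calculus rules for \<open>Ck_on\<close> and \<open>smooth_on\<close>\<close>

lemma Ck_on_subset: "Ck_on k S f \<Longrightarrow> T \<subseteq> S \<Longrightarrow> Ck_on k T f"
  by (induction k arbitrary: f) (auto intro: continuous_on_subset)

lemma frechet_derivative_cong:
  assumes "open S" "x \<in> S" "\<And>y. y \<in> S \<Longrightarrow> f y = g y"
  shows "frechet_derivative f (at x) = frechet_derivative g (at x)"
proof -
  have "(f has_derivative D) (at x) \<longleftrightarrow> (g has_derivative D) (at x)" for D
    using has_derivative_transform_within_open[OF _ assms(1,2)] assms(3) by metis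
  then show ?thesis by (simp add: frechet_derivative_def)
qed

lemma Ck_on_cong:
  assumes "Ck_on k S f" "open S" "\<And>x. x \<in> S \<Longrightarrow> f x = g x"
  shows "Ck_on k S g"
  using assms(1,3)
proof (induction k arbitrary: f g)
  case 0
  then show ?case by (metis Ck_on.simps(1) continuous_on_cong)
next
  case (Suc k)
  have "g differentiable at x" if "x \<in> S" for x
    using Suc.prems that has_derivative_transform_within_open[OF _ assms(2) that]
    unfolding Ck_on.simps differentiable_def by metis
  moreover have "Ck_on k S (\<lambda>x. frechet_derivative g (at x) v)" for v
  proof (rule Suc.IH)
    show "Ck_on k S (\<lambda>x. frechet_derivative f (at x) v)" using Suc.prems by simp
    show "frechet_derivative f (at x) v = frechet_derivative g (at x) v" if "x \<in> S" for x
      using frechet_derivative_cong[OF assms(2) that] Suc.prems(2) by metis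
  qed
  ultimately show ?case by simp
qed

lemma Ck_on_local:
  assumes "\<And>x. x \<in> S \<Longrightarrow> \<exists>T. open T \<and> x \<in> T \<and> Ck_on k T f"
  shows "Ck_on k S f"
  using assms
proof (induction k arbitrary: f)
  case 0
  then show ?case
    by (auto intro!: continuous_at_imp_continuous_on) (metis continuous_on_eq_continuous_at)
next
  case (Suc k)
  show ?case unfolding Ck_on.simps
  proof (intro conjI ballI allI)
    show "f differentiable at x" if "x \<in> S" for x using Suc.prems[OF that] by auto
    show "Ck_on k S (\<lambda>x. frechet_derivative f (at x) v)" for v
      by (rule Suc.IH) (use Suc.prems in fastforce)
  qed
qed

lemma Ck_on_Suc_imp: "Ck_on (Suc k) S f \<Longrightarrow> Ck_on k S f"
proof (induction k arbitrary: f)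
  case 0
  then show ?case
    by (auto intro!: continuous_at_imp_continuous_on differentiable_imp_continuous_within)
next
  case (Suc k)
  then show ?case by (metis Ck_on.simps(2))
qed

lemma frechet_derivativeI: "(f has_derivative D) (at x) \<Longrightarrow> frechet_derivative f (at x) v = D v"
  by (metis frechet_derivative_at)

lemma frechet_derivativeD: "f differentiable at x \<Longrightarrow> (f has_derivative frechet_derivative f (at x)) (at x)"
  by (simp add: frechet_derivative_works)

text \<open>Replaces the choice operator inside \<open>frechet_derivative\<close> by an explicit
  derivative \<open>D\<close>. The closure rules below use it in an induction on the order that
  generalizes over the functions, because \<open>D x v\<close> is again built from functions of one
  order less.\<close>

lemma Ck_on_SucI:
  assumes "open S" "\<And>x. x \<in> S \<Longrightarrow> (f has_derivative D x) (at x)" "\<And>v. Ck_on k S (\<lambda>x. D x v)"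
  shows "Ck_on (Suc k) S f"
  unfolding Ck_on.simps
proof (intro conjI ballI allI)
  show "f differentiable at x" if "x \<in> S" for x using assms(2)[OF that] by (auto simp: differentiable_def)
  show "Ck_on k S (\<lambda>x. frechet_derivative f (at x) v)" for v
    by (rule Ck_on_cong[OF assms(3)[of v] assms(1)]) (metis assms(2) frechet_derivativeI)
qed

lemma Ck_on_SucD:
  assumes "Ck_on (Suc k) S f"
  shows "x \<in> S \<Longrightarrow> (f has_derivative frechet_derivative f (at x)) (at x)"
    "Ck_on k S (\<lambda>x. frechet_derivative f (at x) v)"
  using assms by (auto intro: frechet_derivativeD)

lemma Ck_on_const: "Ck_on k S (\<lambda>x. c)"
proof (induction k arbitrary: c)
  case (Suc k)
  have "frechet_derivative (\<lambda>x. c) (at x) = (\<lambda>v. 0)" for x :: 'a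
    by (metis frechet_derivative_at has_derivative_const)
  with Suc show ?case by simp
qed simp

lemma Ck_on_bounded_linear:
  assumes "bounded_linear L" "Ck_on k S f" "open S"
  shows "Ck_on k S (\<lambda>x. L (f x))"
  using assms(2)
proof (induction k arbitrary: f)
  case 0
  then show ?case using bounded_linear.continuous_on[OF assms(1)] by simp
next
  case (Suc k)
  show ?case
    by (rule Ck_on_SucI[OF assms(3) bounded_linear.has_derivative[OF assms(1) Ck_on_SucD(1)[OF Suc.prems]]])
      (auto intro: Suc.IH Ck_on_SucD(2)[OF Suc.prems])
qed

lemma Ck_on_id: "open S \<Longrightarrow> Ck_on k S (\<lambda>x. x)"
proof (cases k)
  case (Suc j)
  assume "open S"
  then show ?thesis unfolding Suc by (intro Ck_on_SucI[OF _ has_derivative_ident] Ck_on_const)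
qed simp

lemma Ck_on_add:
  assumes "Ck_on k S f" "Ck_on k S g" "open S"
  shows "Ck_on k S (\<lambda>x. f x + g x)"
  using assms(1,2)
proof (induction k arbitrary: f g)
  case 0
  then show ?case by (simp add: continuous_on_add)
next
  case (Suc k)
  show ?case
    by (rule Ck_on_SucI[OF assms(3) has_derivative_add[OF Ck_on_SucD(1)[OF Suc.prems(1)] Ck_on_SucD(1)[OF Suc.prems(2)]]])
      (auto intro: Suc.IH Ck_on_SucD(2)[OF Suc.prems(1)] Ck_on_SucD(2)[OF Suc.prems(2)])
qed

lemma Ck_on_sum:
  assumes "\<And>i. i \<in> I \<Longrightarrow> Ck_on k S (f i)" "open S"
  shows "Ck_on k S (\<lambda>x. \<Sum>i\<in>I. f i x)"
proof (cases "finite I")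
  case True
  then show ?thesis using assms
    by (induction I) (auto intro: Ck_on_const Ck_on_add)
qed (simp add: Ck_on_const)

lemma Ck_on_scaleR:
  assumes "Ck_on k S f" "Ck_on k S g" "open S"
  shows "Ck_on k S (\<lambda>x. f x *\<^sub>R g x)"
  using assms(1,2)
proof (induction k arbitrary: f g)
  case 0
  then show ?case by (simp add: continuous_on_scaleR)
next
  case (Suc k)
  note D = Ck_on_SucD[OF Suc.prems(1)] Ck_on_SucD[OF Suc.prems(2)]
  show ?case
    by (rule Ck_on_SucI[OF assms(3) has_derivative_scaleR[OF D(1) D(3)]])
      (auto intro!: Ck_on_add Suc.IH D assms(3) Ck_on_Suc_imp[OF Suc.prems(1)] Ck_on_Suc_imp[OF Suc.prems(2)])
qed

text \<open>The chain rule gives \<open>g'(h x) (h' x v)\<close>, whose direction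
  \<open>h' x v\<close> varies with \<open>x\<close>, while \<open>Ck_on\<close> controls
  derivatives in fixed directions only. Expanding \<open>h' x v\<close> in a finite orthonormal set
  of the middle space turns it into a finite sum of products with fixed directions \<open>b\<close>,
  to which the induction hypothesis applies.\<close>

lemma Ck_on_compose:
  fixes h :: "'a::real_normed_vector \<Rightarrow> 'b::real_inner"
  assumes fd: "finite_dimensional TYPE('b)"
    and "open S" "open T" "Ck_on k S h" "Ck_on k T g" "h ` S \<subseteq> T"
  shows "Ck_on k S (\<lambda>x. g (h x))"
proof -
  obtain B :: "'b set" where B: "finite B" "\<And>x. (\<Sum>b\<in>B. (x \<bullet> b) *\<^sub>R b) = x"
    using fd finite_orthonormal_expansion unfolding finite_dimensional_def by metis
  show ?thesis using assms(4,5)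
  proof (induction k arbitrary: g)
    case 0
    then show ?case using assms by (auto intro: continuous_on_compose2)
  next
    case (Suc k)
    let ?D = "\<lambda>x v. \<Sum>b\<in>B. (frechet_derivative h (at x) v \<bullet> b) *\<^sub>R frechet_derivative g (at (h x)) b"
    show ?case
    proof (rule Ck_on_SucI[OF assms(2)])
      fix x assume x: "x \<in> S"
      then have hx: "h x \<in> T" using assms by auto
      note dg = Ck_on_SucD(1)[OF Suc.prems(2) hx]
      interpret bounded_linear "frechet_derivative g (at (h x))"
        using dg by (rule has_derivative_bounded_linear)
      have "frechet_derivative g (at (h x)) (frechet_derivative h (at x) v) = ?D x v" for v
        by (subst B(2)[symmetric, of "frechet_derivative h (at x) v"]) (simp add: sum scaleR)
      with has_derivative_compose[OF Ck_on_SucD(1)[OF Suc.prems(1) x] dg]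
      show "((\<lambda>x. g (h x)) has_derivative ?D x) (at x)" by simp
    next
      show "Ck_on k S (\<lambda>x. ?D x v)" for v
        using Ck_on_Suc_imp[OF Suc.prems(1)] Ck_on_SucD(2)[OF Suc.prems(1)] Ck_on_SucD(2)[OF Suc.prems(2)]
        by (intro Ck_on_sum Ck_on_scaleR assms(2) Suc.IH Ck_on_bounded_linear[OF bounded_linear_inner_left]) auto
    qed
  qed
qed

lemma Ck_on_Pair:
  assumes "Ck_on k S f" "Ck_on k S g" "open S"
  shows "Ck_on k S (\<lambda>x. (f x, g x))"
proof -
  have "bounded_linear (\<lambda>x::'b. (x, 0::'c))" "bounded_linear (\<lambda>x::'c. (0::'b, x))"
    by (auto intro: bounded_linear_Pair bounded_linear_ident bounded_linear_zero)
  from Ck_on_add[OF Ck_on_bounded_linear[OF this(1) assms(1,3)] Ck_on_bounded_linear[OF this(2) assms(2,3)] assms(3)]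
  show ?thesis by simp
qed

lemma smooth_on_subset: "smooth_on S f \<Longrightarrow> T \<subseteq> S \<Longrightarrow> smooth_on T f"
  by (auto simp: smooth_on_def intro: Ck_on_subset)

lemma smooth_on_cong: "smooth_on S f \<Longrightarrow> open S \<Longrightarrow> (\<And>x. x \<in> S \<Longrightarrow> f x = g x) \<Longrightarrow> smooth_on S g"
  unfolding smooth_on_def by (metis Ck_on_cong)

lemma smooth_on_local:
  "(\<And>x. x \<in> S \<Longrightarrow> \<exists>T. open T \<and> x \<in> T \<and> smooth_on T f) \<Longrightarrow> smooth_on S f"
  unfolding smooth_on_def by (intro allI Ck_on_local) metis

lemma smooth_on_const: "smooth_on S (\<lambda>x. c)"
  by (simp add: smooth_on_def Ck_on_const)

lemma smooth_on_id: "open S \<Longrightarrow> smooth_on S (\<lambda>x. x)"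
  by (simp add: smooth_on_def Ck_on_id)

lemma smooth_on_bounded_linear:
  "bounded_linear L \<Longrightarrow> smooth_on S f \<Longrightarrow> open S \<Longrightarrow> smooth_on S (\<lambda>x. L (f x))"
  by (simp add: smooth_on_def Ck_on_bounded_linear)

lemma smooth_on_add: "smooth_on S f \<Longrightarrow> smooth_on S g \<Longrightarrow> open S \<Longrightarrow> smooth_on S (\<lambda>x. f x + g x)"
  by (simp add: smooth_on_def Ck_on_add)

lemma smooth_on_scaleR: "smooth_on S f \<Longrightarrow> smooth_on S g \<Longrightarrow> open S \<Longrightarrow> smooth_on S (\<lambda>x. f x *\<^sub>R g x)"
  by (simp add: smooth_on_def Ck_on_scaleR)

lemma smooth_on_mult:
  fixes f g :: "_ \<Rightarrow> real"
  shows "smooth_on S f \<Longrightarrow> smooth_on S g \<Longrightarrow> open S \<Longrightarrow> smooth_on S (\<lambda>x. f x * g x)"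
  using smooth_on_scaleR[of S f g] by simp

lemma smooth_on_minus:
  assumes "smooth_on S f" "smooth_on S g" "open S" 
  shows "smooth_on S (\<lambda>x. f x - g x)"
  using smooth_on_add[OF assms(1) smooth_on_scaleR[OF smooth_on_const[of S "-1"] assms(2,3)] assms(3)] by simp

lemma smooth_on_Pair: "smooth_on S f \<Longrightarrow> smooth_on S g \<Longrightarrow> open S \<Longrightarrow> smooth_on S (\<lambda>x. (f x, g x))"
  by (simp add: smooth_on_def Ck_on_Pair)

lemma smooth_on_compose:
  fixes h :: "'a::real_normed_vector \<Rightarrow> 'b::real_inner"
  assumes "finite_dimensional TYPE('b)" "smooth_on T g" "smooth_on S h" "open S" "open T" "h ` S \<subseteq> T"
  shows "smooth_on S (\<lambda>x. g (h x))"
  using assms by (simp add: smooth_on_def Ck_on_compose[OF assms(1)])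

lemma smooth_on_derivative:
  assumes "smooth_on S f"
  shows "x \<in> S \<Longrightarrow> (f has_derivative frechet_derivative f (at x)) (at x)"
    "smooth_on S (\<lambda>x. frechet_derivative f (at x) v)"
  using assms unfolding smooth_on_def by (blast intro: Ck_on_SucD)+

lemma smooth_on_imp_continuous_on: "smooth_on S f \<Longrightarrow> continuous_on S f"
  unfolding smooth_on_def by (metis Ck_on.simps(1))

section \<open>Symmetry of second derivatives\<close>

lemma DERIV_along_line:
  fixes c :: "'a::real_normed_vector \<Rightarrow> real"
  assumes "(c has_derivative D) (at (p + s *\<^sub>R u))"
  shows "((\<lambda>s. c (p + s *\<^sub>R u)) has_real_derivative D u) (at s)"
proof -
  have "((\<lambda>s. p + s *\<^sub>R u) has_derivative (\<lambda>h. h *\<^sub>R u)) (at s)"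
    by (auto intro!: derivative_eq_intros)
  from has_derivative_compose[OF this assms]
  have "((\<lambda>s. c (p + s *\<^sub>R u)) has_derivative (\<lambda>h. D (h *\<^sub>R u))) (at s)" .
  moreover have "D (h *\<^sub>R u) = D u * h" for h
    using has_derivative_bounded_linear[OF assms] by (simp add: bounded_linear.linear linear_cmul)
  ultimately show ?thesis by (simp add: has_field_derivative_def)
qed

text \<open>The mean value theorem is applied twice: in direction \<open>u\<close> to the increment
  of \<open>c\<close> under \<open>h *\<^sub>R v\<close>, then in direction \<open>v\<close> to the
  resulting first derivative.\<close>

lemma second_difference_MVT:
  fixes c :: "'a::real_normed_vector \<Rightarrow> real"
  assumes "Ck_on 2 (ball z \<rho>) c" "0 < h" "h * norm u + h * norm v < \<rho>"
  shows "\<exists>x\<in>ball z \<rho>. c (z + h *\<^sub>R u + h *\<^sub>R v) - c (z + h *\<^sub>R u) - c (z + h *\<^sub>R v) + c z =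
     h * (h * frechet_derivative (\<lambda>y. frechet_derivative c (at y) u) (at x) v)"
proof -
  let ?d = "\<lambda>y. frechet_derivative c (at y) u"
  let ?dd = "\<lambda>x. frechet_derivative ?d (at x) v"
  have in_ball: "z + s *\<^sub>R u + t *\<^sub>R v \<in> ball z \<rho>" if "0 \<le> s" "s \<le> h" "0 \<le> t" "t \<le> h" for s t
  proof -
    have "norm (s *\<^sub>R u + t *\<^sub>R v) \<le> s * norm u + t * norm v"
      using norm_triangle_ineq[of "s *\<^sub>R u" "t *\<^sub>R v"] that by simp
    also have "\<dots> \<le> h * norm u + h * norm v" using that by (intro add_mono mult_right_mono) auto
    finally have "norm (s *\<^sub>R u + t *\<^sub>R v) < \<rho>" using assms(3) by linarith
    moreover have "dist z (z + s *\<^sub>R u + t *\<^sub>R v) = norm (s *\<^sub>R u + t *\<^sub>R v)"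
      by (metis add.assoc add_diff_cancel_left' dist_commute dist_norm)
    ultimately show ?thesis by simp
  qed
  have C2: "Ck_on (Suc (Suc 0)) (ball z \<rho>) c" using assms(1) by (simp add: numeral_2_eq_2)
  have dc: "(c has_derivative frechet_derivative c (at x)) (at x)" if "x \<in> ball z \<rho>" for x
    using Ck_on_SucD(1)[OF C2 that] .
  have dd: "(?d has_derivative frechet_derivative ?d (at x)) (at x)" if "x \<in> ball z \<rho>" for x
    using Ck_on_SucD(1)[OF Ck_on_SucD(2)[OF C2] that] .
  let ?g = "\<lambda>s. c (z + h *\<^sub>R v + s *\<^sub>R u) - c (z + s *\<^sub>R u)"
  have "\<exists>\<xi>>0. \<xi> < h \<and> ?g h - ?g 0 = (h - 0) * (?d (z + h *\<^sub>R v + \<xi> *\<^sub>R u) - ?d (z + \<xi> *\<^sub>R u))"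
  proof (rule MVT2[OF assms(2)])
    fix s assume s: "0 \<le> s" "s \<le> h"
    have "z + h *\<^sub>R v + s *\<^sub>R u \<in> ball z \<rho>" "z + s *\<^sub>R u \<in> ball z \<rho>"
      using in_ball[of s h] in_ball[of s 0] s by (simp_all add: ac_simps)
    then show "(?g has_real_derivative ?d (z + h *\<^sub>R v + s *\<^sub>R u) - ?d (z + s *\<^sub>R u)) (at s)"
      by (intro DERIV_diff DERIV_along_line dc)
  qed
  then obtain \<xi> where \<xi>: "0 < \<xi>" "\<xi> < h" "?g h - ?g 0 = h * (?d (z + h *\<^sub>R v + \<xi> *\<^sub>R u) - ?d (z + \<xi> *\<^sub>R u))" by auto
  have "\<exists>\<eta>>0. \<eta> < h \<and> ?d (z + \<xi> *\<^sub>R u + h *\<^sub>R v) - ?d (z + \<xi> *\<^sub>R u + 0 *\<^sub>R v) = (h - 0) * ?dd (z + \<xi> *\<^sub>R u + \<eta> *\<^sub>R v)"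
  proof (rule MVT2[OF assms(2)])
    fix s assume "0 \<le> s" "s \<le> h"
    then have "z + \<xi> *\<^sub>R u + s *\<^sub>R v \<in> ball z \<rho>" using \<xi> by (intro in_ball) auto
    then show "((\<lambda>s. ?d (z + \<xi> *\<^sub>R u + s *\<^sub>R v)) has_real_derivative ?dd (z + \<xi> *\<^sub>R u + s *\<^sub>R v)) (at s)"
      by (intro DERIV_along_line dd)
  qed
  then obtain \<eta> where \<eta>: "0 < \<eta>" "\<eta> < h" "?d (z + \<xi> *\<^sub>R u + h *\<^sub>R v) - ?d (z + \<xi> *\<^sub>R u) = h * ?dd (z + \<xi> *\<^sub>R u + \<eta> *\<^sub>R v)" by auto
  have "?g h - ?g 0 = h * (h * ?dd (z + \<xi> *\<^sub>R u + \<eta> *\<^sub>R v))"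
    unfolding \<xi>(3) \<eta>(3)[symmetric] by (simp add: ac_simps)
  then show ?thesis
    by (intro bexI[of _ "z + \<xi> *\<^sub>R u + \<eta> *\<^sub>R v"] in_ball) (use \<xi> \<eta> in \<open>auto simp: ac_simps\<close>)
qed

text \<open>The second difference of \<open>c\<close> does not change when \<open>u\<close> and
  \<open>v\<close> are swapped, so the two mixed derivatives agree at two points near
  \<open>z\<close>; continuity then forces their values at \<open>z\<close> to be arbitrarily
  close.\<close>

lemma frechet_derivative_symmetric:
  fixes c :: "'a::real_normed_vector \<Rightarrow> real"
  assumes "Ck_on 2 S c" "open S" "z \<in> S"
  shows "frechet_derivative (\<lambda>y. frechet_derivative c (at y) u) (at z) v =
    frechet_derivative (\<lambda>y. frechet_derivative c (at y) v) (at z) u"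
    (is "?A u v z = ?A v u z")
proof -
  have cont: "continuous_on S (?A u v)" for u v
    using assms(1) by (simp add: numeral_2_eq_2)
  have "\<bar>?A u v z - ?A v u z\<bar> < e" if "e > 0" for e
  proof -
    have near: "\<forall>\<^sub>F x in nhds z. dist (?A u v x) (?A u v z) < e / 2" for u v
    proof -
      have "isCont (?A u v) z"
        using cont assms(2,3) continuous_on_eq_continuous_at by blast
      moreover have "\<forall>\<^sub>F x in nhds z. dist (f x) (f z) < e / 2" if "isCont f z" for f :: "'a \<Rightarrow> real"
        using that \<open>e > 0\<close> tendstoD[of f "f z" "nhds z" "e / 2"]
        by (simp add: isCont_def tendsto_at_iff_tendsto_nhds del: less_divide_eq_numeral1)
      ultimately show ?thesis by blast
    qed
    have "\<forall>\<^sub>F x in nhds z. x \<in> S \<and> dist (?A u v x) (?A u v z) < e / 2 \<and> dist (?A v u x) (?A v u z) < e / 2"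
      using near[of u v] near[of v u] eventually_nhds_in_open[OF assms(2,3)]
      by eventually_elim auto
    then obtain \<rho> where \<rho>: "\<rho> > 0" "\<And>x. x \<in> ball z \<rho> \<Longrightarrow>
        x \<in> S \<and> dist (?A u v x) (?A u v z) < e / 2 \<and> dist (?A v u x) (?A v u z) < e / 2"
      unfolding eventually_nhds_metric by (auto simp: dist_commute)
    \<comment> \<open>The summand 1 makes the denominator positive and the inequality
      \<open>h * norm u + h * norm v < \<rho>\<close> strict.\<close>
    define h where "h = \<rho> / (norm u + norm v + 1)"
    have n: "norm u + norm v + 1 > 0" by (smt (verit) norm_ge_zero)
    then have h: "h > 0" using \<rho>(1) by (simp add: h_def)
    have "h * (norm u + norm v + 1) = \<rho>" using n by (simp add: h_def)
    then have hl: "h * norm u + h * norm v < \<rho>" "h * norm v + h * norm u < \<rho>"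
      using h by (auto simp: algebra_simps)
    have C: "Ck_on 2 (ball z \<rho>) c"
      by (rule Ck_on_subset[OF assms(1)]) (use \<rho>(2) in auto)
    obtain x where x: "x \<in> ball z \<rho>" "c (z + h *\<^sub>R u + h *\<^sub>R v) - c (z + h *\<^sub>R u) - c (z + h *\<^sub>R v) + c z = h * (h * ?A u v x)"
      using second_difference_MVT[OF C h hl(1)] by auto
    obtain y where y: "y \<in> ball z \<rho>" "c (z + h *\<^sub>R v + h *\<^sub>R u) - c (z + h *\<^sub>R v) - c (z + h *\<^sub>R u) + c z = h * (h * ?A v u y)"
      using second_difference_MVT[OF C h hl(2)] by auto
    have "h * (h * ?A u v x) = h * (h * ?A v u y)"
      unfolding x(2)[symmetric] y(2)[symmetric] by (simp add: ac_simps)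
    then have "?A u v x = ?A v u y" using h by simp
    moreover have "dist (?A u v x) (?A u v z) < e / 2" "dist (?A v u y) (?A v u z) < e / 2"
      using \<rho>(2) x(1) y(1) by blast+
    ultimately show ?thesis unfolding dist_real_def by linarith
  qed
  \<comment> \<open>If the values differed, their distance could be taken for \<open>e\<close> and
    would be smaller than itself.\<close>
  from this[of "\<bar>?A u v z - ?A v u z\<bar>"] show ?thesis by (cases "?A u v z = ?A v u z") auto
qed

text \<open>By Cauchy-Schwarz the coordinates of points of the ball are bounded, so the ball is a
  closed subset of a coordinate box. The box is compact by induction on the set of directions, as a
  sum of a segment and a smaller box.\<close>

lemma compact_cball_finite_dimensional:
  assumes "finite_dimensional TYPE('a::real_inner)"
  shows "compact (cball (p::'a) r)"
proof -
  obtain B :: "'a set" where B: "finite B" "\<And>x. (\<Sum>b\<in>B. (x \<bullet> b) *\<^sub>R b) = x"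
    using assms finite_orthonormal_expansion unfolding finite_dimensional_def by metis
  define box where "box M B = {\<Sum>b\<in>B. c b *\<^sub>R b | c. \<forall>b\<in>B. \<bar>c b\<bar> \<le> M}" for M and B :: "'a set"
  have "compact (box M B)" for M using B(1)
  proof (induction B)
    case empty
    then show ?case by (simp add: box_def)
  next
    case (insert a B)
    have "compact ((\<lambda>c. c *\<^sub>R a) ` {-M..M})"
      by (intro compact_continuous_image continuous_intros) simp
    from compact_sums[OF this insert.IH]
    have "compact {x + y |x y. x \<in> (\<lambda>c. c *\<^sub>R a) ` {-M..M} \<and> y \<in> box M B}" .
    also have "{x + y |x y. x \<in> (\<lambda>c. c *\<^sub>R a) ` {-M..M} \<and> y \<in> box M B} = box M (insert a B)" (is "?L = ?R")
    proof (intro equalityI subsetI)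
      fix w assume "w \<in> ?L"
      then obtain k c where *: "w = k *\<^sub>R a + (\<Sum>b\<in>B. c b *\<^sub>R b)" "\<bar>k\<bar> \<le> M" "\<forall>b\<in>B. \<bar>c b\<bar> \<le> M"
        unfolding box_def by fastforce
      have "(\<Sum>b\<in>B. c b *\<^sub>R b) = (\<Sum>b\<in>B. (c(a := k)) b *\<^sub>R b)"
        by (intro sum.cong) (use insert in auto)
      then have "w = (\<Sum>b\<in>insert a B. (c(a := k)) b *\<^sub>R b)" using * insert by simp
      moreover have "\<forall>b\<in>insert a B. \<bar>(c(a := k)) b\<bar> \<le> M" using * by auto
      ultimately show "w \<in> ?R" unfolding box_def by blast
    next
      fix w assume "w \<in> ?R"
      then obtain c where c: "w = (\<Sum>b\<in>insert a B. c b *\<^sub>R b)" "\<forall>b\<in>insert a B. \<bar>c b\<bar> \<le> M"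
        unfolding box_def by auto
      then have "w = c a *\<^sub>R a + (\<Sum>b\<in>B. c b *\<^sub>R b)" "c a \<in> {-M..M}"
        using insert by auto
      with c(2) show "w \<in> ?L" unfolding box_def by blast
    qed
    finally show ?case .
  qed
  moreover obtain M where M: "\<And>x b. x \<in> cball p r \<Longrightarrow> b \<in> B \<Longrightarrow> \<bar>x \<bullet> b\<bar> \<le> M"
  proof -
    have "\<bar>x \<bullet> b\<bar> \<le> (norm p + r) * (\<Sum>b\<in>B. norm b)" if "x \<in> cball p r" "b \<in> B" for x b
    proof -
      have "norm x \<le> norm p + r"
        using that(1) norm_triangle_ineq2[of x p] by (auto simp: dist_norm norm_minus_commute)
      moreover have "norm b \<le> (\<Sum>b\<in>B. norm b)" using that(2) B(1) by (intro member_le_sum) auto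
      ultimately have "norm x * norm b \<le> (norm p + r) * (\<Sum>b\<in>B. norm b)"
        by (intro mult_mono) (auto intro: order_trans[OF norm_ge_zero])
      then show ?thesis using Cauchy_Schwarz_ineq2[of x b] by linarith
    qed
    then show ?thesis using that by blast
  qed
  have "cball p r \<subseteq> box M B"
  proof
    fix x assume "x \<in> cball p r"
    then show "x \<in> box M B" unfolding box_def
      using M B(2)[of x] by (intro CollectI exI[of _ "\<lambda>b. x \<bullet> b"]) auto
  qed
  ultimately show ?thesis
    by (metis closed_cball compact_Int_closed inf.absorb_iff2)
qed

text \<open>The powers of \<open>1/t\<close> make this family closed under differentiation up to linear combinations, so
  that smoothness follows by induction on the order.\<close>

definition flat_fun :: "nat \<Rightarrow> real \<Rightarrow> real" where
  "flat_fun n t = (if t > 0 then exp (- inverse t) * inverse t ^ n else 0)"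

lemma flat_fun_tendsto_0: "(flat_fun n \<longlongrightarrow> 0) (at 0)"
proof -
  have "((\<lambda>t. inverse t ^ n / exp (inverse t)) \<longlongrightarrow> 0) (at_right (0::real))"
    using tendsto_power_div_exp_0[of n] filterlim_inverse_at_top_right by (rule filterlim_compose)
  then have "(flat_fun n \<longlongrightarrow> 0) (at_right 0)"
    by (rule Lim_transform_eventually)
      (auto simp: flat_fun_def eventually_at_filter exp_minus divide_inverse ac_simps)
  moreover have "(flat_fun n \<longlongrightarrow> 0) (at_left 0)"
    by (rule tendsto_eventually) (auto simp: flat_fun_def eventually_at_filter)
  ultimately show ?thesis by (simp add: filterlim_split_at)
qed

lemma flat_fun_DERIV:
  "(flat_fun n has_real_derivative flat_fun (n + 2) t - real n * flat_fun (n + 1) t) (at t)"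
proof -
  consider "t > 0" | "t < 0" | "t = 0" by linarith
  then show ?thesis
  proof cases
    case 1
    let ?e = "exp (- inverse t)"
    have "((\<lambda>t. exp (- inverse t) * inverse t ^ n) has_real_derivative
        ?e * inverse t ^ 2 * inverse t ^ n - ?e * (real n * inverse t ^ (n - 1) * inverse t ^ 2)) (at t)"
      using 1 by (auto intro!: derivative_eq_intros simp: power2_eq_square)
    moreover have "?e * inverse t ^ 2 * inverse t ^ n - ?e * (real n * inverse t ^ (n - 1) * inverse t ^ 2) =
        flat_fun (n + 2) t - real n * flat_fun (n + 1) t"
      using 1 by (cases n) (simp_all add: flat_fun_def power2_eq_square)
    ultimately have "((\<lambda>t. exp (- inverse t) * inverse t ^ n) has_real_derivative
        flat_fun (n + 2) t - real n * flat_fun (n + 1) t) (at t)" by simp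
    then show ?thesis
      by (rule has_field_derivative_transform_within_open[of _ _ _ "{0<..}"]) (use 1 in \<open>auto simp: flat_fun_def\<close>)
  next
    case 2
    have "((\<lambda>t. 0) has_real_derivative flat_fun (n + 2) t - real n * flat_fun (n + 1) t) (at t)"
      using 2 by (simp add: flat_fun_def)
    then show ?thesis
      by (rule has_field_derivative_transform_within_open[of _ _ _ "{..<0}"]) (use 2 in \<open>auto simp: flat_fun_def\<close>)
  next
    case 3
    \<comment> \<open>The difference quotient at 0 is \<open>flat_fun (Suc n)\<close> away from 0,
      so the limit already known for the next index settles this case.\<close>
    have "((\<lambda>h. (flat_fun n (0 + h) - flat_fun n 0) / h) \<longlongrightarrow> 0) (at 0)"
      using flat_fun_tendsto_0[of "Suc n"]
      by (rule Lim_transform_eventually) (auto simp: flat_fun_def eventually_at_filter divide_inverse)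
    then show ?thesis using 3 by (simp add: DERIV_def flat_fun_def)
  qed
qed

lemma Ck_on_flat_fun: "Ck_on k UNIV (flat_fun n)"
proof (induction k arbitrary: n)
  case 0
  then show ?case
    by (auto intro!: continuous_at_imp_continuous_on DERIV_isCont[OF flat_fun_DERIV])
next
  case (Suc k)
  show ?case
  proof (rule Ck_on_SucI)
    show "(flat_fun n has_derivative (\<lambda>v. v *\<^sub>R (flat_fun (n + 2) t + (- real n) *\<^sub>R flat_fun (n + 1) t))) (at t)" for t
      using flat_fun_DERIV[of n t] by (simp add: has_field_derivative_def mult_commute_abs)
    show "Ck_on k UNIV (\<lambda>t. v *\<^sub>R (flat_fun (n + 2) t + (- real n) *\<^sub>R flat_fun (n + 1) t))" for v
      by (intro Ck_on_scaleR Ck_on_add Ck_on_const Suc.IH open_UNIV)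
  qed simp
qed

lemma smooth_on_flat_fun: "smooth_on UNIV (flat_fun n)"
  by (simp add: smooth_on_def Ck_on_flat_fun)

section \<open>Differentiation under the integral and Hadamard's lemma\<close>

text \<open>The weight \<open>s ^ m\<close> is there because the chain rule along the ray brings out
  one factor \<open>s\<close> for each derivative; with \<open>m\<close> arbitrary the derivative is
  an integral of the same form.\<close>

lemma has_derivative_radial_integral:
  fixes w :: "'a::real_inner \<Rightarrow> real"
  assumes fd: "finite_dimensional TYPE('a)"
    and w: "smooth_on (ball p0 R) w" and p: "p \<in> ball p0 R"
  shows "((\<lambda>p. integral {0..1} (\<lambda>s. s ^ m * w (p0 + s *\<^sub>R (p - p0)))) has_derivative
     (\<lambda>v. integral {0..1} (\<lambda>s. s ^ Suc m * frechet_derivative w (at (p0 + s *\<^sub>R (p - p0))) v))) (at p)"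
proof -
  obtain B :: "'a set" where B: "finite B" "\<And>x. (\<Sum>b\<in>B. (x \<bullet> b) *\<^sub>R b) = x"
    using fd finite_orthonormal_expansion unfolding finite_dimensional_def by metis
  let ?W = "ball p0 R"
  define q where "q s x = p0 + s *\<^sub>R (x - p0)" for s x
  define d where "d y = frechet_derivative w (at y)" for y
  have q_in: "q s x \<in> ?W" if "x \<in> ?W" "s \<in> {0..1}" for s x
  proof -
    have "dist p0 (q s x) = s * dist p0 x" using that(2) by (simp add: q_def dist_norm norm_minus_commute)
    also have "\<dots> \<le> dist p0 x" using that(2) by (simp add: mult_left_le_one_le)
    finally show ?thesis using that(1) by simp
  qed
  have dw: "(w has_derivative d y) (at y)" if "y \<in> ?W" for y
    using smooth_on_derivative(1)[OF w that] by (simp add: d_def)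
  have cd: "continuous_on ?W (\<lambda>y. d y v)" for v
    using smooth_on_imp_continuous_on[OF smooth_on_derivative(2)[OF w]] by (simp add: d_def)
  have cw: "continuous_on ?W w" using w by (rule smooth_on_imp_continuous_on)
  have cq: "continuous_on (?W \<times> {0..1}) (\<lambda>z. q (snd z) (fst z))"
    unfolding q_def by (intro continuous_intros)
  have qs: "continuous_on {0..1} (\<lambda>s. q s x)" for x
    unfolding q_def by (intro continuous_intros)
  have d_sum: "d y v = (\<Sum>b\<in>B. (v \<bullet> b) * d y b)" if "y \<in> ?W" for y v
  proof -
    interpret bounded_linear "d y" using dw[OF that] by (rule has_derivative_bounded_linear)
    show ?thesis by (subst B(2)[symmetric, of v]) (simp add: sum scaleR)
  qed
  have i1: "(\<lambda>s. s ^ m * w (q s x)) integrable_on {0..1}" if "x \<in> ?W" for x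
    by (intro integrable_continuous_interval continuous_intros continuous_on_compose2[OF cw qs])
      (use q_in that in auto)
  have i2: "(\<lambda>s. s ^ Suc m * d (q s x) v) integrable_on {0..1}" if "x \<in> ?W" for x v
    by (intro integrable_continuous_interval continuous_intros continuous_on_compose2[OF cd qs])
      (use q_in that in auto)
  have lin: "bounded_linear (\<lambda>v. integral {0..1} (\<lambda>s. s ^ Suc m * d (q s p) v))"
  proof -
    define c where "c b = integral {0..1} (\<lambda>s. s ^ Suc m * d (q s p) b)" for b
    have "integral {0..1} (\<lambda>s. s ^ Suc m * d (q s p) v) = (\<Sum>b\<in>B. (v \<bullet> b) * c b)" for v
    proof -
      have "integral {0..1} (\<lambda>s. s ^ Suc m * d (q s p) v) =
          integral {0..1} (\<lambda>s. \<Sum>b\<in>B. (v \<bullet> b) * (s ^ Suc m * d (q s p) b))"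
        by (rule integral_cong) (use q_in[OF p] in \<open>simp add: d_sum[of _ v] sum_distrib_left ac_simps\<close>)
      also have "\<dots> = (\<Sum>b\<in>B. integral {0..1} (\<lambda>s. (v \<bullet> b) * (s ^ Suc m * d (q s p) b)))"
        by (rule integral_sum[OF B(1)])
          (use integrable_cmul[OF i2[OF p], unfolded real_scaleR_def] in \<open>simp del: power_Suc\<close>)
      finally show ?thesis by (simp add: c_def)
    qed
    then show ?thesis
      by (simp only:) (intro bounded_linear_sum bounded_linear_mult_const bounded_linear_inner_left)
  qed
  \<comment> \<open>A sum that bounds the operator norm of \<open>d (q s x) - d (q s p)\<close> and,
    unlike that norm, is visibly continuous in \<open>(x, s)\<close>. It vanishes at
    \<open>x = p\<close>.\<close>
  define \<psi> where "\<psi> z = (\<Sum>b\<in>B. norm b * \<bar>d (q (snd z) (fst z)) b - d (q (snd z) p) b\<bar>)" for z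
  have c\<psi>: "continuous_on (?W \<times> {0..1}) \<psi>"
    unfolding \<psi>_def
    by (intro continuous_intros continuous_on_compose2[OF cd cq] continuous_on_compose2[OF cd continuous_on_compose2[OF qs[of p] continuous_on_snd[OF continuous_on_id]]])
      (use q_in p in auto)
  have "\<exists>\<delta>>0. \<forall>x. norm (x - p) < \<delta> \<longrightarrow>
      norm (integral {0..1} (\<lambda>s. s ^ m * w (q s x)) - integral {0..1} (\<lambda>s. s ^ m * w (q s p)) -
        integral {0..1} (\<lambda>s. s ^ Suc m * d (q s p) (x - p))) \<le> e * norm (x - p)" if e: "e > 0" for e
  proof -
    \<comment> \<open>Compactness of the parameter interval makes the neighbourhood of
      \<open>p\<close> independent of \<open>s\<close>.\<close>
    obtain X0 where X0: "p \<in> X0" "open X0"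
        "\<forall>x\<in>X0 \<inter> ?W. \<forall>t\<in>{0..1}. dist (\<psi> (x, t)) (\<psi> (p, t)) \<le> e"
      by (rule continuous_on_prod_compactE[OF c\<psi> compact_Icc p e])
    obtain \<delta> where \<delta>: "\<delta> > 0" "ball p \<delta> \<subseteq> X0 \<inter> ?W"
      by (metis IntI X0(1,2) open_Int open_ball openE p)
    show ?thesis
    proof (intro exI[of _ \<delta>] conjI allI impI \<delta>(1))
      fix x assume "norm (x - p) < \<delta>"
      then have x: "x \<in> ball p \<delta>" by (simp add: dist_norm norm_minus_commute)
      then have xW: "x \<in> ?W" using \<delta> by auto
      \<comment> \<open>With the linear part at \<open>p\<close> subtracted, the derivative of
        \<open>?r s\<close> is at most \<open>e\<close> in norm near \<open>p\<close>, so the mean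
        value inequality bounds the remainder for each \<open>s\<close>; integration over
        \<open>s\<close> keeps the bound.\<close>
      let ?r = "\<lambda>s x. s ^ m * w (q s x) - s ^ Suc m * d (q s p) x"
      have est: "norm (?r s x - ?r s p) \<le> e * norm (x - p)" if s: "s \<in> {0..1}" for s
      proof (rule differentiable_bound[of "ball p \<delta>" "?r s" "\<lambda>y v. s ^ Suc m * d (q s y) v - s ^ Suc m * d (q s p) v"])
        fix y assume y: "y \<in> ball p \<delta>"
        then have yW: "y \<in> ?W" using \<delta> by auto
        have "(q s has_derivative (\<lambda>v. s *\<^sub>R v)) (at y)"
          unfolding q_def by (auto intro!: derivative_eq_intros)
        from has_derivative_compose[OF this dw[OF q_in[OF yW s]]]
        have 1: "((\<lambda>x. w (q s x)) has_derivative (\<lambda>v. d (q s y) (s *\<^sub>R v))) (at y)" .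
        have 2: "bounded_linear (d z)" if "z \<in> ?W" for z using dw[OF that] by (rule has_derivative_bounded_linear)
        have "d (q s y) (s *\<^sub>R v) = s * d (q s y) v" for v
          using 2[OF q_in[OF yW s]] by (simp add: bounded_linear.linear linear_cmul)
        with 1 have 3: "((\<lambda>x. w (q s x)) has_derivative (\<lambda>v. s * d (q s y) v)) (at y)" by simp
        have "(?r s has_derivative (\<lambda>v. s ^ m * (s * d (q s y) v) - s ^ Suc m * d (q s p) v)) (at y)"
          by (intro has_derivative_diff has_derivative_mult_right 3 bounded_linear_imp_has_derivative 2 q_in p s)
        then show "(?r s has_derivative (\<lambda>v. s ^ Suc m * d (q s y) v - s ^ Suc m * d (q s p) v)) (at y within ball p \<delta>)"
          by (auto intro!: has_derivative_at_withinI simp: ac_simps)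
        show "onorm (\<lambda>v. s ^ Suc m * d (q s y) v - s ^ Suc m * d (q s p) v) \<le> e"
        proof (rule onorm_bound)
          fix v
          have "norm (s ^ Suc m * d (q s y) v - s ^ Suc m * d (q s p) v) = s ^ Suc m * \<bar>d (q s y) v - d (q s p) v\<bar>"
            using s by (simp add: right_diff_distrib[symmetric] abs_mult)
          also have "\<dots> \<le> 1 * \<bar>d (q s y) v - d (q s p) v\<bar>"
            using s by (intro mult_right_mono power_le_one) auto
          also have "d (q s y) v - d (q s p) v = (\<Sum>b\<in>B. (v \<bullet> b) * (d (q s y) b - d (q s p) b))"
            using q_in[OF yW s] q_in[OF p s] by (simp add: d_sum[of _ v] sum_subtractf[symmetric] right_diff_distrib)
          also have "\<bar>\<dots>\<bar> \<le> (\<Sum>b\<in>B. \<bar>(v \<bullet> b) * (d (q s y) b - d (q s p) b)\<bar>)" by (rule sum_abs)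
          also have "\<dots> \<le> (\<Sum>b\<in>B. (norm v * norm b) * \<bar>d (q s y) b - d (q s p) b\<bar>)"
            unfolding abs_mult by (intro sum_mono mult_right_mono Cauchy_Schwarz_ineq2) auto
          also have "\<dots> = \<psi> (y, s) * norm v" by (simp add: \<psi>_def sum_distrib_left sum_distrib_right ac_simps)
          also have "\<dots> \<le> e * norm v"
          proof (rule mult_right_mono)
            have "dist (\<psi> (y, s)) (\<psi> (p, s)) \<le> e" using X0(3) y \<delta> s by blast
            moreover have "\<psi> (p, s) = 0" by (simp add: \<psi>_def)
            ultimately show "\<psi> (y, s) \<le> e" by (simp add: dist_real_def)
          qed simp
          finally show "norm (s ^ Suc m * d (q s y) v - s ^ Suc m * d (q s p) v) \<le> e * norm v" by simp
        qed (use e in simp)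
      qed (use x \<delta> in auto)
      have dd: "d (q s p) (x - p) = d (q s p) x - d (q s p) p" if "s \<in> {0..1}" for s
        using dw[OF q_in[OF p that]] by (simp add: has_derivative_bounded_linear bounded_linear.linear linear_diff)
      have "norm (integral {0..1} (\<lambda>s. s ^ m * w (q s x)) - integral {0..1} (\<lambda>s. s ^ m * w (q s p)) -
        integral {0..1} (\<lambda>s. s ^ Suc m * d (q s p) (x - p))) =
        norm (integral {0..1} (\<lambda>s. s ^ m * w (q s x) - s ^ m * w (q s p) - s ^ Suc m * d (q s p) (x - p)))"
        using i1[OF xW] i1[OF p] i2[OF p] by (simp add: integral_diff integrable_diff)
      also have "\<dots> \<le> integral {0..1} (\<lambda>s::real. e * norm (x - p))"
      proof (rule integral_norm_bound_integral)
        show "(\<lambda>s. s ^ m * w (q s x) - s ^ m * w (q s p) - s ^ Suc m * d (q s p) (x - p)) integrable_on {0..1}"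
          by (intro integrable_diff i1 i2 p xW)
        show "norm (s ^ m * w (q s x) - s ^ m * w (q s p) - s ^ Suc m * d (q s p) (x - p)) \<le> e * norm (x - p)"
          if "s \<in> {0..1}" for s using est[OF that] by (simp add: dd[OF that] algebra_simps)
      qed auto
      finally show "norm (integral {0..1} (\<lambda>s. s ^ m * w (q s x)) - integral {0..1} (\<lambda>s. s ^ m * w (q s p)) -
        integral {0..1} (\<lambda>s. s ^ Suc m * d (q s p) (x - p))) \<le> e * norm (x - p)" by simp
    qed
  qed
  then have "((\<lambda>p. integral {0..1} (\<lambda>s. s ^ m * w (q s p))) has_derivative
     (\<lambda>v. integral {0..1} (\<lambda>s. s ^ Suc m * d (q s p) v))) (at p)"
    unfolding has_derivative_at_alt using lin by auto
  then show ?thesis by (simp add: q_def d_def)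
qed

lemma smooth_on_radial_integral:
  fixes w :: "'a::real_inner \<Rightarrow> real"
  assumes "finite_dimensional TYPE('a)" "smooth_on (ball p0 R) w"
  shows "smooth_on (ball p0 R) (\<lambda>p. integral {0..1} (\<lambda>s. s ^ m * w (p0 + s *\<^sub>R (p - p0))))"
proof -
  have "Ck_on k (ball p0 R) (\<lambda>p. integral {0..1} (\<lambda>s. s ^ m * w (p0 + s *\<^sub>R (p - p0))))" for k
    using assms(2)
  proof (induction k arbitrary: w m)
    case 0
    then show ?case
      using has_derivative_radial_integral[OF assms(1) 0]
      by (auto intro!: continuous_at_imp_continuous_on has_derivative_continuous simp del: power_Suc)
  next
    case (Suc k)
    show ?case
      by (rule Ck_on_SucI[OF open_ball has_derivative_radial_integral[OF assms(1) Suc.prems]])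
        (assumption, rule Suc.IH, rule smooth_on_derivative(2)[OF Suc.prems])
  qed
  then show ?thesis by (simp add: smooth_on_def)
qed

text \<open>The fundamental theorem of calculus on the segment from \<open>p0\<close> to
  \<open>p\<close>, with \<open>p - p0\<close> expanded in \<open>B\<close>, gives the factors as
  integrals of partial derivatives. A ball is used because it contains these segments.\<close>

lemma hadamard:
  fixes u :: "'a::real_inner \<Rightarrow> real"
  assumes fd: "finite_dimensional TYPE('a)" and u: "smooth_on (ball p0 R) u" and "R > 0"
    and B: "finite B" "\<And>x::'a. (\<Sum>b\<in>B. (x \<bullet> b) *\<^sub>R b) = x"
  obtains g where "\<And>b. smooth_on (ball p0 R) (g b)"
    "\<And>p. p \<in> ball p0 R \<Longrightarrow> u p = u p0 + (\<Sum>b\<in>B. ((p - p0) \<bullet> b) * g b p)"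
    "\<And>b. g b p0 = frechet_derivative u (at p0) b"
proof -
  \<comment> \<open>The factor \<open>s ^ 0\<close> only puts the integrand into the shape of
    \<open>smooth_on_radial_integral\<close>. At \<open>p0\<close> the integrand is constant, which
    gives the value of \<open>g b p0\<close>.\<close>
  define g where "g b p = integral {0..1} (\<lambda>s. s ^ 0 * frechet_derivative u (at (p0 + s *\<^sub>R (p - p0))) b)" for b p
  have 1: "smooth_on (ball p0 R) (g b)" for b
    unfolding g_def by (intro smooth_on_radial_integral fd smooth_on_derivative(2) u)
  have 2: "u p = u p0 + (\<Sum>b\<in>B. ((p - p0) \<bullet> b) * g b p)" if p: "p \<in> ball p0 R" for p
  proof -
    define q where "q s = p0 + s *\<^sub>R (p - p0)" for s
    have q_in: "q s \<in> ball p0 R" if "s \<in> {0..1}" for s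
    proof -
      have "dist p0 (q s) = s * dist p0 p" using that by (simp add: q_def dist_norm norm_minus_commute)
      also have "\<dots> \<le> dist p0 p" using that by (simp add: mult_left_le_one_le)
      finally show ?thesis using p by simp
    qed
    have cq: "continuous_on {0..1} q" unfolding q_def by (intro continuous_intros)
    have i: "(\<lambda>s. frechet_derivative u (at (q s)) b) integrable_on {0..1}" for b
      by (intro integrable_continuous_interval continuous_on_compose2[OF smooth_on_imp_continuous_on[OF smooth_on_derivative(2)[OF u]] cq])
        (use q_in in auto)
    have "((\<lambda>s. frechet_derivative u (at (q s)) (p - p0)) has_integral u (q 1) - u (q 0)) {0..1}"
    proof (rule fundamental_theorem_of_calculus)
      fix s :: real assume s: "s \<in> {0..1}"
      have "((\<lambda>s. u (q s)) has_real_derivative frechet_derivative u (at (q s)) (p - p0)) (at s)"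
        unfolding q_def by (rule DERIV_along_line, rule smooth_on_derivative(1)[OF u]) (use q_in[OF s] in \<open>simp add: q_def\<close>)
      then show "((\<lambda>s. u (q s)) has_vector_derivative frechet_derivative u (at (q s)) (p - p0)) (at s within {0..1})"
        by (auto simp: has_real_derivative_iff_has_vector_derivative intro: has_vector_derivative_at_within)
    qed simp
    then have "u p - u p0 = integral {0..1} (\<lambda>s. frechet_derivative u (at (q s)) (p - p0))"
      by (simp add: q_def integral_unique)
    also have "\<dots> = integral {0..1} (\<lambda>s. \<Sum>b\<in>B. ((p - p0) \<bullet> b) * frechet_derivative u (at (q s)) b)"
    proof (rule integral_cong)
      fix s :: real assume "s \<in> {0..1}"
      then interpret bounded_linear "frechet_derivative u (at (q s))"
        using smooth_on_derivative(1)[OF u] q_in by (blast intro: has_derivative_bounded_linear)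
      show "frechet_derivative u (at (q s)) (p - p0) = (\<Sum>b\<in>B. ((p - p0) \<bullet> b) * frechet_derivative u (at (q s)) b)"
        by (subst B(2)[symmetric, of "p - p0"]) (simp add: sum scaleR)
    qed
    also have "\<dots> = (\<Sum>b\<in>B. integral {0..1} (\<lambda>s. ((p - p0) \<bullet> b) * frechet_derivative u (at (q s)) b))"
      by (rule integral_sum[OF B(1)], unfold real_scaleR_def[symmetric], rule integrable_cmul, rule i)
    finally show ?thesis by (simp add: g_def q_def)
  qed
  have "g b p0 = frechet_derivative u (at p0) b" for b by (simp add: g_def)
  with 1 2 show ?thesis using that by blast
qed

section \<open>Functions and derivations on a Lie group\<close>

lemma smooth_on_fst: "open S \<Longrightarrow> smooth_on S fst"
  by (rule smooth_on_bounded_linear[OF bounded_linear_fst smooth_on_id])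

lemma smooth_on_snd: "open S \<Longrightarrow> smooth_on S snd"
  by (rule smooth_on_bounded_linear[OF bounded_linear_snd smooth_on_id])

context lie_group
begin

lemma finite_dimensional_model: "finite_dimensional TYPE('e)"
  using atlas by (simp add: smooth_atlas_def finite_dimensional_def)

lemma chart_around: obtains C where "C \<in> A" "x \<in> fst C"
proof -
  have "x \<in> (\<Union>C\<in>A. fst C)" using atlas by (simp add: smooth_atlas_def)
  then show ?thesis using that by blast
qed

lemma chart:
  assumes "C \<in> A"
  shows open_chart: "open (fst C)" and open_chart_img: "open (chart_img C)"
    and chart_inv_left: "x \<in> fst C \<Longrightarrow> chart_inv C (snd C x) = x"
    and chart_inv_right: "p \<in> chart_img C \<Longrightarrow> snd C (chart_inv C p) = p"
    and chart_inv_in: "p \<in> chart_img C \<Longrightarrow> chart_inv C p \<in> fst C"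
    and continuous_chart: "continuous_on (fst C) (snd C)"
    and continuous_chart_inv: "continuous_on (chart_img C) (chart_inv C)"
proof -
  have *: "open (fst C)" "open (chart_img C)" "homeomorphism (fst C) (chart_img C) (snd C) (chart_inv C)"
    using atlas assms by (auto simp: smooth_atlas_def)
  then show "open (fst C)" "open (chart_img C)" "continuous_on (fst C) (snd C)"
    "continuous_on (chart_img C) (chart_inv C)" by (auto simp: homeomorphism_def)
  show "x \<in> fst C \<Longrightarrow> chart_inv C (snd C x) = x" "p \<in> chart_img C \<Longrightarrow> snd C (chart_inv C p) = p"
    using *(3) by (auto simp: homeomorphism_def)
  show "p \<in> chart_img C \<Longrightarrow> chart_inv C p \<in> fst C" using inv_into_into by metis
qed

section \<open>Smooth maps into the group and smooth functions on it\<close>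

text \<open>Openness and continuity are included so that the preimages of chart domains are open, as
  the calculus rules for \<open>smooth_on\<close> require.\<close>

definition smooth_into :: "'w::real_normed_vector set \<Rightarrow> ('w \<Rightarrow> 'g) \<Rightarrow> bool" where
  "smooth_into S \<sigma> \<longleftrightarrow> open S \<and> continuous_on S \<sigma> \<and>
     (\<forall>E\<in>A. smooth_on (S \<inter> \<sigma> -` fst E) (\<lambda>w. snd E (\<sigma> w)))"

lemma smooth_into_open: "smooth_into S \<sigma> \<Longrightarrow> open U \<Longrightarrow> open (S \<inter> \<sigma> -` U)"
  by (auto simp: smooth_into_def intro: continuous_open_preimage)

lemma smooth_into_const: "open S \<Longrightarrow> smooth_into S (\<lambda>w. x)"
  by (simp add: smooth_into_def smooth_on_const)

lemma smooth_into_chart_inv: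
  assumes C: "C \<in> A"
  shows "smooth_into (chart_img C) (chart_inv C)"
  unfolding smooth_into_def
proof (intro conjI ballI)
  fix E assume E: "E \<in> A"
  have "smooth_on (snd C ` (fst C \<inter> fst E)) (\<lambda>x. snd E (chart_inv C x))"
    using atlas C E by (auto simp: smooth_atlas_def)
  moreover have "chart_img C \<inter> chart_inv C -` fst E \<subseteq> snd C ` (fst C \<inter> fst E)"
    using chart_inv_left[OF C] by force
  ultimately show "smooth_on (chart_img C \<inter> chart_inv C -` fst E) (\<lambda>x. snd E (chart_inv C x))"
    by (rule smooth_on_subset)
qed (use C in \<open>auto intro: open_chart_img continuous_chart_inv\<close>)

lemma smooth_into_compose:
  fixes h :: "'w::real_normed_vector \<Rightarrow> 'v::real_inner"
  assumes fd: "finite_dimensional TYPE('v)" and s: "smooth_into T \<sigma>"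
    and h: "smooth_on S h" "open S" "h ` S \<subseteq> T"
  shows "smooth_into S (\<lambda>w. \<sigma> (h w))"
proof -
  have ch: "continuous_on S h" using h(1) by (rule smooth_on_imp_continuous_on)
  have c: "continuous_on S (\<lambda>w. \<sigma> (h w))"
    using s h ch by (auto simp: smooth_into_def intro: continuous_on_compose2)
  have "smooth_on (S \<inter> (\<lambda>w. \<sigma> (h w)) -` fst E) (\<lambda>w. snd E (\<sigma> (h w)))" if E: "E \<in> A" for E
  proof (rule smooth_on_compose[OF fd, of "T \<inter> \<sigma> -` fst E" "\<lambda>v. snd E (\<sigma> v)"])
    show "smooth_on (T \<inter> \<sigma> -` fst E) (\<lambda>v. snd E (\<sigma> v))" using s E by (simp add: smooth_into_def)
    show "open (T \<inter> \<sigma> -` fst E)" using s E by (intro smooth_into_open open_chart)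
    show "open (S \<inter> (\<lambda>w. \<sigma> (h w)) -` fst E)"
      by (rule continuous_open_preimage[OF c h(2) open_chart[OF E]])
  qed (use h in \<open>auto intro: smooth_on_subset\<close>)
  then show ?thesis using c h(2) by (simp add: smooth_into_def)
qed

text \<open>Near a given parameter both factors stay in one chart each, so the product is the smooth
  coordinate expression of the multiplication composed with a pair of smooth maps.\<close>

lemma smooth_into_mult:
  assumes s: "smooth_into S \<sigma>" and t: "smooth_into S \<tau>"
  shows "smooth_into S (\<lambda>w. \<sigma> w \<otimes> \<tau> w)"
proof -
  have S: "open S" using s by (simp add: smooth_into_def)
  have cont: "continuous_on S (\<lambda>w. \<sigma> w \<otimes> \<tau> w)"
    using continuous_on_compose2[OF continuous_mult, of S "\<lambda>w. (\<sigma> w, \<tau> w)"] s t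
    by (auto simp: smooth_into_def intro: continuous_on_Pair)
  have "smooth_on (S \<inter> (\<lambda>w. \<sigma> w \<otimes> \<tau> w) -` fst E) (\<lambda>w. snd E (\<sigma> w \<otimes> \<tau> w))" if E: "E \<in> A" for E
  proof (rule smooth_on_local)
    fix w assume w: "w \<in> S \<inter> (\<lambda>w. \<sigma> w \<otimes> \<tau> w) -` fst E"
    obtain C where C: "C \<in> A" "\<sigma> w \<in> fst C" by (rule chart_around)
    obtain D where D: "D \<in> A" "\<tau> w \<in> fst D" by (rule chart_around)
    let ?T = "(S \<inter> \<sigma> -` fst C) \<inter> (S \<inter> \<tau> -` fst D) \<inter> (S \<inter> (\<lambda>w. \<sigma> w \<otimes> \<tau> w) -` fst E)"
    have T: "open ?T"
      by (intro open_Int[OF open_Int] smooth_into_open s t open_chart C(1) D(1)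
          continuous_open_preimage[OF cont S] E)
    let ?m = "\<lambda>p. chart_inv C (fst p) \<otimes> chart_inv D (snd p)"
    let ?M = "{p \<in> chart_img C \<times> chart_img D. ?m p \<in> fst E}"
    have im: "open (chart_img C \<times> chart_img D)" using open_chart_img C(1) D(1) by (intro open_Times) auto
    have "continuous_on (chart_img C \<times> chart_img D) ?m"
    proof (rule continuous_on_compose2[OF continuous_mult, of _ "\<lambda>p. (chart_inv C (fst p), chart_inv D (snd p))", simplified])
      show "continuous_on (chart_img C \<times> chart_img D) (\<lambda>p. (chart_inv C (fst p), chart_inv D (snd p)))"
        by (intro continuous_on_Pair continuous_on_compose2[OF continuous_chart_inv[OF C(1)]]
            continuous_on_compose2[OF continuous_chart_inv[OF D(1)]] continuous_intros) auto
    qed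
    then have M: "open ?M"
      using continuous_open_preimage[OF _ im open_chart[OF E], of ?m] by (simp add: vimage_def Int_def)
    have "smooth_on ?T (\<lambda>w. snd E (?m (snd C (\<sigma> w), snd D (\<tau> w))))"
    proof (rule smooth_on_compose[OF finite_dimensional_prod[OF finite_dimensional_model finite_dimensional_model]
          smooth_mult[OF C(1) D(1) E] _ T M])
      show "smooth_on ?T (\<lambda>w. (snd C (\<sigma> w), snd D (\<tau> w)))"
      proof (intro smooth_on_Pair T)
        show "smooth_on ?T (\<lambda>w. snd C (\<sigma> w))"
          using s C(1) by (auto simp: smooth_into_def intro: smooth_on_subset)
        show "smooth_on ?T (\<lambda>w. snd D (\<tau> w))"
          using t D(1) by (auto simp: smooth_into_def intro: smooth_on_subset)
      qed
      show "(\<lambda>w. (snd C (\<sigma> w), snd D (\<tau> w))) ` ?T \<subseteq> ?M"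
        using chart_inv_left[OF C(1)] chart_inv_left[OF D(1)] by auto
    qed
    then have "smooth_on ?T (\<lambda>w. snd E (\<sigma> w \<otimes> \<tau> w))"
      by (rule smooth_on_cong[OF _ T]) (use chart_inv_left[OF C(1)] chart_inv_left[OF D(1)] in auto)
    moreover have "w \<in> ?T" using w C D by auto
    ultimately show "\<exists>T. open T \<and> w \<in> T \<and> smooth_on T (\<lambda>w. snd E (\<sigma> w \<otimes> \<tau> w))" using T by blast
  qed
  then show ?thesis using S cont by (simp add: smooth_into_def)
qed

lemma smooth_function_compose:
  assumes f: "f \<in> smooth_functions A" and s: "smooth_into S \<sigma>"
  shows "smooth_on S (\<lambda>w. f (\<sigma> w))"
proof (rule smooth_on_local)
  fix w assume w: "w \<in> S"
  obtain C where C: "C \<in> A" "\<sigma> w \<in> fst C" by (rule chart_around)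
  let ?T = "S \<inter> \<sigma> -` fst C"
  have T: "open ?T" by (intro smooth_into_open s open_chart C)
  have "smooth_on ?T (\<lambda>w. f (chart_inv C (snd C (\<sigma> w))))"
    by (rule smooth_on_compose[OF finite_dimensional_model, of "chart_img C" "\<lambda>p. f (chart_inv C p)"])
      (use f s C T in \<open>auto simp: smooth_functions_def smooth_into_def intro: open_chart_img\<close>)
  then have "smooth_on ?T (\<lambda>w. f (\<sigma> w))"
    by (rule smooth_on_cong[OF _ T]) (use chart_inv_left[OF C(1)] in auto)
  then show "\<exists>T. open T \<and> w \<in> T \<and> smooth_on T (\<lambda>w. f (\<sigma> w))" using T w C by blast
qed

lemma smooth_functionI:
  "(\<And>C. C \<in> A \<Longrightarrow> smooth_on (chart_img C) (\<lambda>p. f (chart_inv C p))) \<Longrightarrow> f \<in> smooth_functions A"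
  by (simp add: smooth_functions_def)

lemma smooth_functionD:
  "f \<in> smooth_functions A \<Longrightarrow> C \<in> A \<Longrightarrow> smooth_on (chart_img C) (\<lambda>p. f (chart_inv C p))"
  by (simp add: smooth_functions_def)

lemma smooth_function_left:
  "f \<in> smooth_functions A \<Longrightarrow> (\<lambda>x. f (a \<otimes> x)) \<in> smooth_functions A"
  by (rule smooth_functionI, erule smooth_function_compose, rule smooth_into_mult[OF smooth_into_const smooth_into_chart_inv])
    (auto intro: open_chart_img)

lemma smooth_function_right:
  "f \<in> smooth_functions A \<Longrightarrow> (\<lambda>x. f (x \<otimes> a)) \<in> smooth_functions A"
  by (rule smooth_functionI, erule smooth_function_compose, rule smooth_into_mult[OF smooth_into_chart_inv smooth_into_const])
    (auto intro: open_chart_img)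

lemma smooth_function_const: "(\<lambda>x. c) \<in> smooth_functions A"
  by (simp add: smooth_functions_def smooth_on_const)

lemma smooth_function_0: "0 \<in> smooth_functions A"
  using smooth_function_const[of 0] by (simp add: zero_fun_def)

lemma smooth_function_add:
  "f \<in> smooth_functions A \<Longrightarrow> g \<in> smooth_functions A \<Longrightarrow> f + g \<in> smooth_functions A"
  by (rule smooth_functionI) (simp add: smooth_on_add smooth_functionD open_chart_img)

lemma smooth_function_scaleR: "f \<in> smooth_functions A \<Longrightarrow> r *\<^sub>R f \<in> smooth_functions A"
  by (rule smooth_functionI)
    (simp add: smooth_on_mult smooth_on_const smooth_functionD open_chart_img)

lemma smooth_function_mult:
  "f \<in> smooth_functions A \<Longrightarrow> g \<in> smooth_functions A \<Longrightarrow> f * g \<in> smooth_functions A"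
  by (rule smooth_functionI) (simp add: smooth_on_mult smooth_functionD open_chart_img)

lemma smooth_function_diff:
  "f \<in> smooth_functions A \<Longrightarrow> g \<in> smooth_functions A \<Longrightarrow> f - g \<in> smooth_functions A"
  by (rule smooth_functionI) (simp add: smooth_on_minus smooth_functionD open_chart_img)

lemma smooth_function_sum:
  "(\<And>i. i \<in> I \<Longrightarrow> f i \<in> smooth_functions A) \<Longrightarrow> (\<Sum>i\<in>I. f i) \<in> smooth_functions A"
  by (induction I rule: infinite_finite_induct) (simp_all add: smooth_function_0 smooth_function_add)

lemma derivation:
  assumes "derivation_field A X"
  shows derivation_nonsmooth: "f \<notin> smooth_functions A \<Longrightarrow> X f = 0"
    and derivation_smooth: "X f \<in> smooth_functions A"
    and derivation_add: "f \<in> smooth_functions A \<Longrightarrow> g \<in> smooth_functions A \<Longrightarrow> X (f + g) = X f + X g"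
    and derivation_scaleR: "f \<in> smooth_functions A \<Longrightarrow> X (r *\<^sub>R f) = r *\<^sub>R X f"
    and derivation_mult: "f \<in> smooth_functions A \<Longrightarrow> g \<in> smooth_functions A \<Longrightarrow> X (f * g) = X f * g + f * X g"
proof -
  note X = assms[unfolded derivation_field_def]
  show nonsmooth: "X f = 0" if "f \<notin> smooth_functions A" using X that by blast
  show "X f \<in> smooth_functions A"
    by (cases "f \<in> smooth_functions A") (use X nonsmooth smooth_function_0 in auto)
  show "X (f + g) = X f + X g" "X (f * g) = X f * g + f * X g"
    if "f \<in> smooth_functions A" "g \<in> smooth_functions A" using X that by blast+
  show "X (r *\<^sub>R f) = r *\<^sub>R X f" if "f \<in> smooth_functions A" using X that by blast
qed

lemma derivation_0: "derivation_field A X \<Longrightarrow> X 0 = 0"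
  using derivation_scaleR[of X 0 0] smooth_function_0 by simp

lemma derivation_diff:
  assumes "derivation_field A X" "f \<in> smooth_functions A" "g \<in> smooth_functions A"
  shows "X (f - g) = X f - X g"
  using derivation_add[OF assms(1) assms(2) smooth_function_scaleR[OF assms(3), of "-1"]]
    derivation_scaleR[OF assms(1,3), of "-1"] by simp

lemma derivation_const:
  assumes "derivation_field A X"
  shows "X (\<lambda>x. c) = 0"
proof -
  have "X ((\<lambda>x. 1) * (\<lambda>x. 1)) = X (\<lambda>x. 1) * (\<lambda>x. 1) + (\<lambda>x. 1) * X (\<lambda>x. 1)"
    by (intro derivation_mult assms smooth_function_const)
  then have "X (\<lambda>x. 1) = 0" by (simp add: times_fun_def fun_eq_iff)
  moreover have "(\<lambda>x. c) = c *\<^sub>R (\<lambda>x::'g. 1)" by (simp add: fun_eq_iff)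
  ultimately show ?thesis
    using derivation_scaleR[OF assms smooth_function_const, of c 1] by simp
qed

lemma derivation_sum:
  assumes "derivation_field A X" "\<And>i. i \<in> I \<Longrightarrow> f i \<in> smooth_functions A"
  shows "X (\<Sum>i\<in>I. f i) = (\<Sum>i\<in>I. X (f i))"
  using assms(2)
  by (induction I rule: infinite_finite_induct)
    (simp_all add: derivation_0 derivation_add smooth_function_sum assms(1) fun_eq_iff)

text \<open>Turns a function on a ball in a chart into one on which a derivation can act. The bump
  is supported in the smaller ball of radius \<open>r\<close>, which leaves room inside the ball of
  radius \<open>R\<close> where \<open>u\<close> is smooth.\<close>

lemma smooth_function_extension:
  assumes C: "C \<in> A" and r: "0 < r" "r < R" and ball: "ball p0 R \<subseteq> chart_img C"
    and u: "smooth_on (ball p0 R) u"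
  shows "(\<lambda>y. if y \<in> fst C then flat_fun 0 (r\<^sup>2 - (norm (snd C y - p0))\<^sup>2) * u (snd C y) else 0)
    \<in> smooth_functions A" (is "?F \<in> _")
proof (rule smooth_functionI, rule smooth_on_local)
  fix D z assume D: "D \<in> A" and z: "z \<in> chart_img D"
  let ?v = "\<lambda>p. flat_fun 0 (r\<^sup>2 - (norm (p - p0))\<^sup>2) * u p"
  have cD: "open (chart_img D \<inter> chart_inv D -` U)" if "open U" for U
    by (intro smooth_into_open smooth_into_chart_inv D that)
  show "\<exists>T. open T \<and> z \<in> T \<and> smooth_on T (\<lambda>p. ?F (chart_inv D p))"
  proof (cases "chart_inv D z \<in> fst C \<inter> snd C -` ball p0 R")
    case True
    let ?T = "chart_img D \<inter> chart_inv D -` (fst C \<inter> snd C -` ball p0 R)"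
    have T: "open ?T"
      by (intro cD continuous_open_preimage continuous_chart open_chart C open_ball)
    have sv: "smooth_on (ball p0 R) ?v"
    proof (intro smooth_on_mult u open_ball)
      obtain B :: "'e set" where B: "finite B" "\<And>x. (\<Sum>b\<in>B. (x \<bullet> b) *\<^sub>R b) = x"
        using finite_dimensional_model finite_orthonormal_expansion unfolding finite_dimensional_def by metis
      \<comment> \<open>The squared norm is a quadratic polynomial in the coordinates and so is
        smooth also at the centre.\<close>
      have "(norm (p - p0))\<^sup>2 = (\<Sum>b\<in>B. ((p - p0) \<bullet> b) * ((p - p0) \<bullet> b))" for p
      proof -
        have "(p - p0) \<bullet> (p - p0) = (p - p0) \<bullet> (\<Sum>b\<in>B. ((p - p0) \<bullet> b) *\<^sub>R b)" by (simp only: B(2))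
        then show ?thesis by (simp add: power2_norm_eq_inner inner_sum_right)
      qed
      moreover have "smooth_on (ball p0 R) (\<lambda>p. \<Sum>b\<in>B. ((p - p0) \<bullet> b) * ((p - p0) \<bullet> b))"
      proof -
        have "smooth_on (ball p0 R) (\<lambda>p. (p - p0) \<bullet> b)" for b
          by (intro smooth_on_bounded_linear[OF bounded_linear_inner_left] smooth_on_minus
              smooth_on_id smooth_on_const open_ball)
        then have "smooth_on (ball p0 R) (\<lambda>p. ((p - p0) \<bullet> b) * ((p - p0) \<bullet> b))" for b
          by (intro smooth_on_mult open_ball) auto
        then show ?thesis unfolding smooth_on_def by (intro allI Ck_on_sum) auto
      qed
      ultimately have "smooth_on (ball p0 R) (\<lambda>p. r\<^sup>2 - (norm (p - p0))\<^sup>2)"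
        by (simp add: smooth_on_minus[OF smooth_on_const])
      then show "smooth_on (ball p0 R) (\<lambda>p. flat_fun 0 (r\<^sup>2 - (norm (p - p0))\<^sup>2))"
        by (intro smooth_on_compose[OF finite_dimensional_real smooth_on_flat_fun]) auto
    qed
    have "smooth_on ?T (\<lambda>p. snd C (chart_inv D p))"
      using smooth_into_chart_inv[OF D] C unfolding smooth_into_def
      by (elim conjE) (drule bspec, assumption, auto elim!: smooth_on_subset)
    then have "smooth_on ?T (\<lambda>p. ?v (snd C (chart_inv D p)))"
      by (intro smooth_on_compose[OF finite_dimensional_model sv] T) auto
    then have "smooth_on ?T (\<lambda>p. ?F (chart_inv D p))"
      by (rule smooth_on_cong[OF _ T]) auto
    then show ?thesis using T True z by (intro exI[of _ ?T]) auto
  next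
    case False
    \<comment> \<open>This set is compact, hence closed because the group is Hausdorff. Off it the
      extension vanishes, so points outside the chart ball have a whole neighbourhood on which it is
      0.\<close>
    let ?K = "chart_inv C ` cball p0 r"
    have sub: "cball p0 r \<subseteq> ball p0 R" using r by auto
    then have "compact ?K"
      using continuous_chart_inv[OF C] ball
      by (intro compact_continuous_image compact_cball_finite_dimensional finite_dimensional_model)
        (auto intro: continuous_on_subset)
    then have "open (- ?K)" by (simp add: compact_imp_closed open_closed)
    let ?T = "chart_img D \<inter> chart_inv D -` (- ?K)"
    have T: "open ?T" using \<open>open (- ?K)\<close> by (rule cD)
    have "chart_inv C p \<in> fst C \<inter> snd C -` ball p0 R" if "p \<in> cball p0 r" for p
    proof -
      have "p \<in> ball p0 R" using that sub by blast
      moreover from this have "p \<in> chart_img C" using ball by blast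
      ultimately show ?thesis using chart_inv_in[OF C, of p] chart_inv_right[OF C, of p] by simp
    qed
    then have "z \<in> ?T" using False z by fastforce
    have "?F y = 0" if "y \<notin> ?K" for y
    proof (cases "y \<in> fst C")
      case True
      then have "snd C y \<notin> cball p0 r" using that chart_inv_left[OF C] by force
      then have "r < norm (snd C y - p0)" by (simp add: dist_norm norm_minus_commute)
      then have "r\<^sup>2 < (norm (snd C y - p0))\<^sup>2" using r by (intro power_strict_mono) auto
      then show ?thesis by (simp add: flat_fun_def)
    qed simp
    then have "smooth_on ?T (\<lambda>p. ?F (chart_inv D p))"
      by (intro smooth_on_cong[OF smooth_on_const[of _ 0] T]) auto
    then show ?thesis using T \<open>z \<in> ?T\<close> by blast
  qed
qed

end

section \<open>Derivations as directional derivatives\<close>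

lemma has_derivative_partial:
  assumes "(c has_derivative D) (at (w, p))"
  shows "((\<lambda>p. c (w, p)) has_derivative (\<lambda>v. D (0, v))) (at p)"
proof -
  have "((\<lambda>p. (w, p)) has_derivative (\<lambda>v. (0, v))) (at p)"
    by (auto intro!: derivative_eq_intros)
  from has_derivative_compose[OF this assms] show ?thesis .
qed

context lie_group
begin

text \<open>The Leibniz rule is applied to Hadamard's expansion of \<open>f - f x\<close>. Every
  coordinate factor vanishes at \<open>x\<close>, so only the terms in which \<open>X\<close> hits
  that factor survive.\<close>

lemma derivation_at_point:
  assumes X: "derivation_field A X" and C: "C \<in> A" "x \<in> fst C"
  obtains a where "\<And>f. f \<in> smooth_functions A \<Longrightarrow>
    X f x = frechet_derivative (\<lambda>p. f (chart_inv C p)) (at (snd C x)) a"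
proof -
  obtain B :: "'e set" where B: "finite B" "\<And>x. (\<Sum>b\<in>B. (x \<bullet> b) *\<^sub>R b) = x"
    using finite_dimensional_model finite_orthonormal_expansion unfolding finite_dimensional_def by metis
  define p0 where "p0 = snd C x"
  obtain R where R: "R > 0" "ball p0 R \<subseteq> chart_img C"
    using open_chart_img[OF C(1)] C(2) unfolding p0_def by (metis imageI open_contains_ball)
  define r where "r = R / 2"
  have r: "0 < r" "r < R" using R by (auto simp: r_def)
  define bump where "bump p = flat_fun 0 (r\<^sup>2 - (norm (p - p0))\<^sup>2)" for p
  define ext where "ext u = (\<lambda>y. if y \<in> fst C then bump (snd C y) * u (snd C y) else 0)" for u
  have ext: "ext u \<in> smooth_functions A" if "smooth_on (ball p0 R) u" for u
    unfolding ext_def bump_def by (rule smooth_function_extension[OF C(1) r R(2) that])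
  have bump_0: "bump p = 0" if "p \<notin> ball p0 R" for p
  proof -
    have "r < norm (p - p0)" using that r by (simp add: dist_norm norm_minus_commute)
    then have "r\<^sup>2 < (norm (p - p0))\<^sup>2" using r by (intro power_strict_mono) auto
    then show ?thesis by (simp add: bump_def flat_fun_def)
  qed
  \<comment> \<open>The bump is not normalized to 1 at the centre; its value there is divided out in
    the definition of \<open>a\<close> and at the end.\<close>
  define c where "c = bump p0"
  have c: "c \<noteq> 0" using r by (simp add: c_def bump_def flat_fun_def)
  define cut where "cut = ext (\<lambda>p. 1)"
  have cut: "cut \<in> smooth_functions A" unfolding cut_def by (intro ext smooth_on_const)
  have chi_x: "cut x = c" using C by (simp add: cut_def ext_def c_def p0_def)
  define \<xi> where "\<xi> b = ext (\<lambda>p. (p - p0) \<bullet> b)" for b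
  have \<xi>: "\<xi> b \<in> smooth_functions A" for b unfolding \<xi>_def
    by (intro ext smooth_on_bounded_linear[OF bounded_linear_inner_left] smooth_on_minus
        smooth_on_id smooth_on_const open_ball)
  have xi_x: "\<xi> b x = 0" for b by (simp add: \<xi>_def ext_def p0_def)
  define a where "a = (\<Sum>b\<in>B. (X (\<xi> b) x / c) *\<^sub>R b)"
  have "X f x = frechet_derivative (\<lambda>p. f (chart_inv C p)) (at (snd C x)) a" if f: "f \<in> smooth_functions A" for f
  proof -
    define u where "u p = f (chart_inv C p)" for p
    have u: "smooth_on (ball p0 R) u"
      using smooth_functionD[OF f C(1)] R(2) unfolding u_def by (rule smooth_on_subset)
    obtain g where g: "\<And>b. smooth_on (ball p0 R) (g b)"
      "\<And>p. p \<in> ball p0 R \<Longrightarrow> u p = u p0 + (\<Sum>b\<in>B. ((p - p0) \<bullet> b) * g b p)"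
      "\<And>b. g b p0 = frechet_derivative u (at p0) b"
      using hadamard[OF finite_dimensional_model u R(1) B] by blast
    define w where "w = f - (\<lambda>y. f x)"
    have w: "w \<in> smooth_functions A" unfolding w_def by (intro smooth_function_diff f smooth_function_const)
    have wx: "w x = 0" by (simp add: w_def)
    have eg: "ext (g b) \<in> smooth_functions A" for b by (rule ext[OF g(1)])
    have u0: "u p0 = f x" using chart_inv_left[OF C] by (simp add: u_def p0_def)
    \<comment> \<open>Two cutoffs on the left, because on the right both \<open>\<xi> b\<close> and
      \<open>ext (g b)\<close> contain one bump factor. This makes the expansion an identity on the
      whole group.\<close>
    have eq: "cut * (cut * w) = (\<Sum>b\<in>B. \<xi> b * ext (g b))"
    proof
      fix y
      have sum_app: "(\<Sum>b\<in>B. \<xi> b * ext (g b)) y = (\<Sum>b\<in>B. \<xi> b y * ext (g b) y)"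
        using B(1) by induction auto
      show "(cut * (cut * w)) y = (\<Sum>b\<in>B. \<xi> b * ext (g b)) y"
      proof (cases "y \<in> fst C \<and> snd C y \<in> ball p0 R")
        case True
        then have "w y = (\<Sum>b\<in>B. ((snd C y - p0) \<bullet> b) * g b (snd C y))"
          using g(2)[of "snd C y"] chart_inv_left[OF C(1)] u0 by (simp add: u_def w_def)
        with True show ?thesis unfolding sum_app
          by (simp add: cut_def \<xi>_def ext_def sum_distrib_left ac_simps)
      next
        case False
        then show ?thesis unfolding sum_app
          using bump_0 by (auto simp: cut_def \<xi>_def ext_def)
      qed
    qed
    have "c * (c * X f x) = X (cut * (cut * w)) x"
    proof -
      have "X w = X f"
        using derivation_diff[OF X f smooth_function_const] derivation_const[OF X] by (simp add: w_def)
      then show ?thesis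
        by (simp add: derivation_mult[OF X] cut w smooth_function_mult chi_x wx)
    qed
    also have "\<dots> = (\<Sum>b\<in>B. X (\<xi> b * ext (g b))) x"
      unfolding eq by (simp add: derivation_sum[OF X] smooth_function_mult \<xi> eg)
    also have "\<dots> = (\<Sum>b\<in>B. X (\<xi> b * ext (g b)) x)"
      using B(1) by induction auto
    also have "\<dots> = (\<Sum>b\<in>B. X (\<xi> b) x * (c * frechet_derivative u (at p0) b))"
    proof (rule sum.cong)
      fix b
      have "ext (g b) x = c * frechet_derivative u (at p0) b"
        using C g(3) by (simp add: ext_def c_def p0_def)
      then show "X (\<xi> b * ext (g b)) x = X (\<xi> b) x * (c * frechet_derivative u (at p0) b)"
        by (simp add: derivation_mult[OF X \<xi> eg] xi_x)
    qed simp
    also have "\<dots> = c * (c * (\<Sum>b\<in>B. (X (\<xi> b) x / c) * frechet_derivative u (at p0) b))"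
      using c by (simp add: sum_distrib_left ac_simps)
    also have "(\<Sum>b\<in>B. (X (\<xi> b) x / c) * frechet_derivative u (at p0) b) = frechet_derivative u (at p0) a"
    proof -
      have "p0 \<in> ball p0 R" using R by simp
      then interpret bounded_linear "frechet_derivative u (at p0)"
        by (rule has_derivative_bounded_linear[OF smooth_on_derivative(1)[OF u]])
      show ?thesis by (simp add: a_def sum scaleR)
    qed
    finally show ?thesis using c by (simp add: u_def[abs_def] p0_def)
  qed
  then show ?thesis using that by blast
qed

section \<open>Left-invariant fields and their dependence on parameters\<close>

lemma lie_algebraD:
  assumes "X \<in> lie_algebra G A"
  shows "derivation_field A X"
    and "f \<in> smooth_functions A \<Longrightarrow> X (\<lambda>y. f (x \<otimes> y)) y = X f (x \<otimes> y)"
  using assms by (auto simp: lie_algebra_def)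

lemma assoc: "x \<otimes> y \<otimes> z = x \<otimes> (y \<otimes> z)"
  using m_assoc by (simp add: carrier_UNIV)

lemma unit [simp]: "x \<otimes> \<one> = x" "\<one> \<otimes> x = x"
  using l_one r_one by (simp_all add: carrier_UNIV)

text \<open>One direction \<open>a\<close> serves all points: the value at \<open>x\<close> is the
  value at the identity on the left translate of \<open>f\<close> by \<open>x\<close>.\<close>

lemma left_invariant_directional:
  assumes X: "X \<in> lie_algebra G A" and C: "C \<in> A" "\<one> \<in> fst C"
  obtains a where "\<And>f x. f \<in> smooth_functions A \<Longrightarrow>
      X f x = frechet_derivative (\<lambda>p. f (x \<otimes> chart_inv C p)) (at (snd C \<one>)) a"
proof -
  obtain a where a: "\<And>f. f \<in> smooth_functions A \<Longrightarrow>
    X f \<one> = frechet_derivative (\<lambda>p. f (chart_inv C p)) (at (snd C \<one>)) a"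
    using derivation_at_point[OF lie_algebraD(1)[OF X] C] by blast
  have "X f x = frechet_derivative (\<lambda>p. f (x \<otimes> chart_inv C p)) (at (snd C \<one>)) a"
    if "f \<in> smooth_functions A" for f x
    using a[OF smooth_function_left[OF that, of x]] lie_algebraD(2)[OF X that, of x \<one>] by simp
  then show ?thesis by (rule that)
qed

lemma smooth_on_two_sided_translate:
  fixes W :: "'w::real_inner set"
  assumes "C \<in> A" and W: "finite_dimensional TYPE('w)" "smooth_into W \<sigma>" "smooth_into W \<tau>"
    and f: "f \<in> smooth_functions A"
  shows "smooth_on (W \<times> chart_img C) (\<lambda>z. f (\<sigma> (fst z) \<otimes> chart_inv C (snd z) \<otimes> \<tau> (fst z)))"
proof (rule smooth_function_compose[OF f])
  have o: "open (W \<times> chart_img C)"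
    using W(2) open_chart_img[OF assms(1)] by (auto simp: smooth_into_def intro: open_Times)
  show "smooth_into (W \<times> chart_img C) (\<lambda>z. \<sigma> (fst z) \<otimes> chart_inv C (snd z) \<otimes> \<tau> (fst z))"
    by (intro smooth_into_mult smooth_into_compose[OF W(1,2) smooth_on_fst]
        smooth_into_compose[OF W(1,3) smooth_on_fst] o
        smooth_into_compose[OF finite_dimensional_model smooth_into_chart_inv[OF assms(1)] smooth_on_snd])
      auto
qed

text \<open>Brings the parameter \<open>w\<close> and the action of \<open>X\<close> into one smooth
  function of \<open>(w, p)\<close>: smoothness and continuity in \<open>w\<close> can then be read
  off its derivative in the fixed direction \<open>(0, a)\<close>.\<close>

lemma left_invariant_two_sided_translate:
  fixes W :: "'w::real_inner set"
  assumes C: "C \<in> A" "\<one> \<in> fst C"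
    and a: "\<And>f x. f \<in> smooth_functions A \<Longrightarrow>
      X f x = frechet_derivative (\<lambda>p. f (x \<otimes> chart_inv C p)) (at (snd C \<one>)) a"
    and W: "finite_dimensional TYPE('w)" "smooth_into W \<sigma>" "smooth_into W \<tau>" "w \<in> W"
    and f: "f \<in> smooth_functions A"
  shows "X (\<lambda>y. f (y \<otimes> \<tau> w)) (\<sigma> w) =
      frechet_derivative (\<lambda>z. f (\<sigma> (fst z) \<otimes> chart_inv C (snd z) \<otimes> \<tau> (fst z))) (at (w, snd C \<one>)) (0, a)"
proof -
  have "(w, snd C \<one>) \<in> W \<times> chart_img C" using W C by auto
  from has_derivative_partial[OF smooth_on_derivative(1)[OF smooth_on_two_sided_translate[OF C(1) W(1-3) f] this]]
  show ?thesis unfolding a[OF smooth_function_right[OF f]]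
    by (intro frechet_derivativeI) simp
qed

section \<open>One-parameter subgroups and the adjoint action\<close>

text \<open>The last claim says that the flow of \<open>Y\<close> is right translation by
  \<open>\<phi>\<close>; it comes from the defining equation at time 0, applied to left translates
  of \<open>f\<close>.\<close>

lemma one_parameter_subgroupD:
  assumes "one_parameter_subgroup G A Y \<phi>" and Y: "Y \<in> lie_algebra G A"
  shows "smooth_into UNIV \<phi>" "\<phi> (s + t) = \<phi> s \<otimes> \<phi> t" "\<phi> 0 = \<one>" "inv (\<phi> t) = \<phi> (- t)"
    and "f \<in> smooth_functions A \<Longrightarrow> ((\<lambda>s. f (x \<otimes> \<phi> s)) has_real_derivative Y f x) (at 0)"
proof -
  show "smooth_into UNIV \<phi>" using assms by (simp add: one_parameter_subgroup_def smooth_into_def)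
  have hom: "\<phi> (s + t) = \<phi> s \<otimes> \<phi> t" for s t using assms by (simp add: one_parameter_subgroup_def)
  then show "\<phi> (s + t) = \<phi> s \<otimes> \<phi> t" .
  have "\<phi> 0 \<otimes> \<phi> 0 = \<phi> 0" using hom[of 0 0] by simp
  then show 0: "\<phi> 0 = \<one>" using l_cancel_one by (simp add: carrier_UNIV)
  have "\<phi> t \<otimes> \<phi> (- t) = \<one>" using hom[of t "- t"] 0 by simp
  then show "inv (\<phi> t) = \<phi> (- t)"
    using inv_equality[of "\<phi> (- t)" "\<phi> t"] hom[of "- t" t] 0 by (simp add: carrier_UNIV)
  assume f: "f \<in> smooth_functions A"
  have "((\<lambda>s. f (x \<otimes> \<phi> s)) has_real_derivative Y (\<lambda>y. f (x \<otimes> y)) (\<phi> 0)) (at 0)"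
    using assms(1)[unfolded one_parameter_subgroup_def, THEN conjunct2, THEN conjunct2, THEN conjunct2,
        rule_format, OF smooth_function_left[OF f, of x], of 0] .
  then show "((\<lambda>s. f (x \<otimes> \<phi> s)) has_real_derivative Y f x) (at 0)"
    by (simp add: lie_algebraD(2)[OF Y f] 0)
qed

text \<open>The two occurrences of \<open>h\<close> are made independent, as \<open>r\<close> and
  \<open>t\<close>. Varying \<open>r\<close> gives \<open>Y (X f)\<close>, varying \<open>t\<close>
  gives \<open>X (Y f)\<close>, and the curve \<open>(h, - h)\<close> picks out their
  difference.\<close>

lemma field_bracket_DERIV_0:
  assumes \<phi>: "one_parameter_subgroup G A Y \<phi>" and Y: "Y \<in> lie_algebra G A"
    and X: "X \<in> lie_algebra G A" and f: "f \<in> smooth_functions A"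
  shows "((\<lambda>h. X (\<lambda>y. f (y \<otimes> \<phi> (- h))) (x \<otimes> \<phi> h)) has_real_derivative field_bracket Y X f x) (at 0)"
proof -
  note phi = one_parameter_subgroupD[OF \<phi> Y]
  obtain C where C: "C \<in> A" "\<one> \<in> fst C" by (rule chart_around)
  obtain a where a: "\<And>f x. f \<in> smooth_functions A \<Longrightarrow>
      X f x = frechet_derivative (\<lambda>p. f (x \<otimes> chart_inv C p)) (at (snd C \<one>)) a"
    using left_invariant_directional[OF X C] by blast
  define p0 where "p0 = snd C \<one>"
  define S where "S = (UNIV :: (real \<times> real) set) \<times> chart_img C"
  define c where "c z = f (x \<otimes> \<phi> (fst (fst z)) \<otimes> chart_inv C (snd z) \<otimes> \<phi> (snd (fst z)))" for z
  define q where "q z = frechet_derivative c (at z) (0, a)" for z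
  have s1: "smooth_into (UNIV :: (real \<times> real) set) (\<lambda>w. x \<otimes> \<phi> (fst w))"
    by (intro smooth_into_mult smooth_into_const smooth_into_compose[OF finite_dimensional_real phi(1) smooth_on_fst]) auto
  have s2: "smooth_into (UNIV :: (real \<times> real) set) (\<lambda>w. \<phi> (snd w))"
    by (intro smooth_into_compose[OF finite_dimensional_real phi(1) smooth_on_snd]) auto
  have c: "smooth_on S c"
    using smooth_on_two_sided_translate[OF C(1) finite_dimensional_prod[OF finite_dimensional_real finite_dimensional_real] s1 s2 f] by (simp add: S_def c_def[abs_def])
  have q: "q ((r, t), p0) = X (\<lambda>y. f (y \<otimes> \<phi> t)) (x \<otimes> \<phi> r)" for r t
    using left_invariant_two_sided_translate[OF C a finite_dimensional_prod[OF finite_dimensional_real finite_dimensional_real] s1 s2 UNIV_I f, of "(r, t)"]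
    by (simp add: q_def c_def[abs_def] p0_def)
  have S: "open S" using open_chart_img[OF C(1)] by (simp add: S_def open_Times)
  have zS: "((r, t), p0) \<in> S" for r t using C by (simp add: S_def p0_def)
  let ?z = "((0::real, 0::real), p0)"
  have "(q has_derivative frechet_derivative q (at ?z)) (at ?z)"
    using smooth_on_derivative(1)[OF smooth_on_derivative(2)[OF c] zS] by (simp add: q_def[abs_def])
  then obtain D where D: "(q has_derivative D) (at ?z)" "D = frechet_derivative q (at ?z)" by blast
  interpret D: bounded_linear D by (rule has_derivative_bounded_linear[OF D(1)])
  have line: "((\<lambda>h. q ((h * u, h * v), p0)) has_real_derivative D ((u, v), 0)) (at 0)" for u v
    using DERIV_along_line[of q D ?z 0 "((u, v), 0)"] D(1) by simp
  have D1: "D ((1, 0), 0) = Y (X f) x"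
  proof (rule DERIV_unique)
    show "((\<lambda>h. X f (x \<otimes> \<phi> h)) has_real_derivative D ((1, 0), 0)) (at 0)"
      using line[of 1 0] by (simp add: q phi(3))
    show "((\<lambda>h. X f (x \<otimes> \<phi> h)) has_real_derivative Y (X f) x) (at 0)"
      by (intro phi(5) derivation_smooth lie_algebraD X)
  qed
  have D2: "D ((0, 1), 0) = X (Y f) x"
  proof -
    \<comment> \<open>The same mixed derivative in the other order: differentiating in
      \<open>t\<close> first produces \<open>Y f\<close> along the chart, and the direction
      \<open>a\<close> then applies \<open>X\<close> to it.\<close>
    define q' where "q' z = frechet_derivative c (at z) ((0, 1), 0)" for z
    have "Ck_on 2 S c" using c by (simp add: smooth_on_def)
    from frechet_derivative_symmetric[OF this S zS[of 0 0], of "(0, a)" "((0, 1), 0)"]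
    have "D ((0, 1), 0) = frechet_derivative q' (at ?z) (0, a)"
      unfolding D(2) q_def[abs_def] q'_def[abs_def] by (simp add: zero_prod_def)
    also have "\<dots> = frechet_derivative (\<lambda>p. q' ((0, 0), p)) (at p0) a"
    proof (rule sym, rule frechet_derivativeI)
      show "((\<lambda>p. q' ((0, 0), p)) has_derivative (\<lambda>v. frechet_derivative q' (at ?z) (0, v))) (at p0)"
        using smooth_on_derivative(1)[OF smooth_on_derivative(2)[OF c] zS]
        by (intro has_derivative_partial) (simp add: q'_def[abs_def])
    qed
    also have "\<dots> = frechet_derivative (\<lambda>p. Y f (x \<otimes> chart_inv C p)) (at p0) a"
    proof (rule fun_cong[OF frechet_derivative_cong[OF open_chart_img[OF C(1)]]])
      show "p0 \<in> chart_img C" using C by (simp add: p0_def)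
      fix p assume p: "p \<in> chart_img C"
      then have "((0, 0), p) \<in> S" by (simp add: S_def)
      from smooth_on_derivative(1)[OF c this]
      have "((\<lambda>h. c (((0, 0), p) + h *\<^sub>R ((0, 1), 0))) has_real_derivative q' ((0, 0), p)) (at 0)"
        unfolding q'_def by (intro DERIV_along_line) simp
      then have "((\<lambda>h. f (x \<otimes> chart_inv C p \<otimes> \<phi> h)) has_real_derivative q' ((0, 0), p)) (at 0)"
        by (simp add: c_def phi(3))
      then show "q' ((0, 0), p) = Y f (x \<otimes> chart_inv C p)"
        by (rule DERIV_unique) (rule phi(5)[OF f])
    qed
    also have "\<dots> = X (Y f) x"
      using a[OF derivation_smooth[OF lie_algebraD(1)[OF Y]], of f x] by (simp add: p0_def)
    finally show ?thesis .
  qed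
  have "D ((1, - 1), 0) = D ((1, 0), 0) - D ((0, 1), 0)"
    by (simp add: D.diff[symmetric])
  then have "((\<lambda>h. q ((h, - h), p0)) has_real_derivative field_bracket Y X f x) (at 0)"
    using line[of 1 "- 1"] D1 D2 by (simp add: field_bracket_def)
  then show ?thesis by (simp add: q)
qed

text \<open>Left invariance absorbs the left factor of the conjugation into the base point, which
  leaves the two-sided form covered by \<open>left_invariant_two_sided_translate\<close>.\<close>

lemma Ad_left_invariant:
  assumes "X \<in> lie_algebra G A" "f \<in> smooth_functions A"
  shows "Ad G k X f x = X (\<lambda>y. f (y \<otimes> inv k)) (x \<otimes> k)"
proof -
  have "Ad G k X f x = X (\<lambda>y. f (k \<otimes> y \<otimes> inv k)) (inv k \<otimes> x \<otimes> k)" by (simp add: Ad_def)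
  also have "\<dots> = X (\<lambda>y. f (y \<otimes> inv k)) (k \<otimes> (inv k \<otimes> x \<otimes> k))"
    using lie_algebraD(2)[OF assms(1) smooth_function_right[OF assms(2), of "inv k"], of k] by simp
  also have "k \<otimes> (inv k \<otimes> x \<otimes> k) = x \<otimes> k"
    using r_inv[of k] by (simp add: carrier_UNIV assoc[symmetric])
  finally show ?thesis .
qed

text \<open>For fixed \<open>f\<close> and \<open>x\<close> the value is continuous in
  \<open>k\<close>, being locally a partial derivative of a smooth function, and a continuous
  function is bounded on a compact set.\<close>

lemma Ad_bounded:
  assumes X: "X \<in> lie_algebra G A" and f: "f \<in> smooth_functions A" and K: "compact K"
  shows "\<exists>M. \<forall>k\<in>K. \<bar>Ad G k X f x\<bar> \<le> M"
proof -
  let ?N = "\<lambda>k. X (\<lambda>y. f (y \<otimes> inv k)) (x \<otimes> k)"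
  obtain C where C: "C \<in> A" "\<one> \<in> fst C" by (rule chart_around)
  obtain a where a: "\<And>f x. f \<in> smooth_functions A \<Longrightarrow>
      X f x = frechet_derivative (\<lambda>p. f (x \<otimes> chart_inv C p)) (at (snd C \<one>)) a"
    using left_invariant_directional[OF X C] by blast
  note fd = finite_dimensional_prod[OF finite_dimensional_model finite_dimensional_model]
  have "isCont ?N k" for k
  proof -
    obtain D where D: "D \<in> A" "k \<in> fst D" by (rule chart_around)
    obtain E where E: "E \<in> A" "inv k \<in> fst E" by (rule chart_around)
    \<comment> \<open>The coordinates of \<open>k\<close> and of \<open>inv k\<close> are treated as
      independent parameters, and continuity of inversion then couples them.\<close>
    let ?W = "chart_img D \<times> chart_img E"
    have W: "open ?W" using open_chart_img D E by (intro open_Times) auto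
    have s1: "smooth_into ?W (\<lambda>w. x \<otimes> chart_inv D (fst w))"
      by (intro smooth_into_mult smooth_into_const W
          smooth_into_compose[OF finite_dimensional_model smooth_into_chart_inv[OF D(1)] smooth_on_fst]) auto
    have s2: "smooth_into ?W (\<lambda>w. chart_inv E (snd w))"
      by (intro W smooth_into_compose[OF finite_dimensional_model smooth_into_chart_inv[OF E(1)] smooth_on_snd]) auto
    define c where "c z = f (x \<otimes> chart_inv D (fst (fst z)) \<otimes> chart_inv C (snd z) \<otimes> chart_inv E (snd (fst z)))" for z
    have "smooth_on (?W \<times> chart_img C) c"
      using smooth_on_two_sided_translate[OF C(1) fd s1 s2 f] by (simp add: c_def[abs_def])
    then have cont: "continuous_on (?W \<times> chart_img C) (\<lambda>z. frechet_derivative c (at z) (0, a))"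
      by (intro smooth_on_imp_continuous_on smooth_on_derivative)
    let ?U = "fst D \<inter> (\<lambda>k. inv k) -` fst E"
    have U: "open ?U"
      using continuous_open_preimage[OF continuous_on_subset[OF continuous_inv subset_UNIV] open_chart[OF D(1)] open_chart[OF E(1)]] .
    have "continuous_on ?U (\<lambda>k. frechet_derivative c (at ((snd D k, snd E (inv k)), snd C \<one>)) (0, a))"
    proof (rule continuous_on_compose2[OF cont])
      show "continuous_on ?U (\<lambda>k. ((snd D k, snd E (inv k)), snd C \<one>))"
        by (intro continuous_on_Pair continuous_on_const continuous_on_subset[OF continuous_chart[OF D(1)]]
            continuous_on_compose2[OF continuous_chart[OF E(1)] continuous_on_subset[OF continuous_inv]]) auto
    qed (use C in auto)
    moreover have "frechet_derivative c (at ((snd D k, snd E (inv k)), snd C \<one>)) (0, a) = ?N k" if "k \<in> ?U" for k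
    proof -
      have "(snd D k, snd E (inv k)) \<in> ?W" using that by auto
      from left_invariant_two_sided_translate[OF C a fd s1 s2 this f] show ?thesis
        using that chart_inv_left[OF D(1), of k] chart_inv_left[OF E(1), of "inv k"] by (simp add: c_def[abs_def])
    qed
    ultimately have "continuous_on ?U ?N" by (rule continuous_on_eq)
    then show ?thesis using U D E continuous_on_eq_continuous_at by blast
  qed
  then have "compact (?N ` K)"
    by (intro compact_continuous_image continuous_at_imp_continuous_on K) auto
  then obtain M where "\<forall>v\<in>?N ` K. norm v \<le> M" using compact_imp_bounded bounded_iff by metis
  then show ?thesis using Ad_left_invariant[OF X f] by auto
qed

lemma field_bracket_lie_algebra:
  assumes X: "X \<in> lie_algebra G A" and Y: "Y \<in> lie_algebra G A"
  shows "field_bracket X Y \<in> lie_algebra G A"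
proof -
  note dX = lie_algebraD(1)[OF X] and dY = lie_algebraD(1)[OF Y]
  have "derivation_field A (field_bracket X Y)"
    unfolding derivation_field_def
  proof (intro conjI allI impI ballI)
    fix f assume "f \<notin> smooth_functions A"
    then show "field_bracket X Y f = 0"
      by (simp add: field_bracket_def derivation_nonsmooth[OF dX] derivation_nonsmooth[OF dY]
          derivation_0[OF dX] derivation_0[OF dY])
  next
    fix f assume f: "f \<in> smooth_functions A"
    show "field_bracket X Y f \<in> smooth_functions A"
      unfolding field_bracket_def by (intro smooth_function_diff derivation_smooth dX dY)
    show "field_bracket X Y (r *\<^sub>R f) = r *\<^sub>R field_bracket X Y f" for r
      unfolding field_bracket_def
      by (simp add: derivation_scaleR[OF dX] derivation_scaleR[OF dY] f derivation_smooth[OF dX]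
          derivation_smooth[OF dY] scaleR_diff_right)
    fix g assume g: "g \<in> smooth_functions A"
    show "field_bracket X Y (f + g) = field_bracket X Y f + field_bracket X Y g"
      unfolding field_bracket_def
      by (simp add: derivation_add[OF dX] derivation_add[OF dY] f g derivation_smooth[OF dX]
          derivation_smooth[OF dY])
    show "field_bracket X Y (f * g) = field_bracket X Y f * g + f * field_bracket X Y g"
      unfolding field_bracket_def
      by (simp add: derivation_mult[OF dX] derivation_mult[OF dY] derivation_add[OF dX] derivation_add[OF dY]
          f g derivation_smooth[OF dX] derivation_smooth[OF dY] smooth_function_mult algebra_simps)
  qed
  moreover have "field_bracket X Y (\<lambda>x. f (a \<otimes> x)) = (\<lambda>x. field_bracket X Y f (a \<otimes> x))"
    if f: "f \<in> smooth_functions A" for a f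
  proof -
    have XY: "X (\<lambda>x. g (a \<otimes> x)) = (\<lambda>x. X g (a \<otimes> x))" "Y (\<lambda>x. g (a \<otimes> x)) = (\<lambda>x. Y g (a \<otimes> x))"
      if "g \<in> smooth_functions A" for g
      using that lie_algebraD(2)[OF X] lie_algebraD(2)[OF Y] by auto
    show ?thesis
      by (simp add: field_bracket_def XY f derivation_smooth[OF dX] derivation_smooth[OF dY] fun_eq_iff)
  qed
  ultimately show ?thesis by (simp add: lie_algebra_def)
qed

text \<open>The homomorphism property moves the derivative from time \<open>t\<close> to time 0,
  with base point \<open>x \<otimes> \<phi> t\<close> and \<open>f\<close> translated on the right
  by \<open>\<phi> (- t)\<close>.\<close>

lemma Ad_DERIV:
  assumes \<phi>: "one_parameter_subgroup G A Y \<phi>" and Y: "Y \<in> lie_algebra G A"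
    and X: "X \<in> lie_algebra G A" and f: "f \<in> smooth_functions A"
  shows "((\<lambda>t. Ad G (\<phi> t) X f x) has_real_derivative Ad G (\<phi> t) (field_bracket Y X) f x) (at t)"
proof -
  note phi = one_parameter_subgroupD[OF \<phi> Y]
  have "((\<lambda>h. X (\<lambda>y. f (y \<otimes> \<phi> (- h) \<otimes> \<phi> (- t))) (x \<otimes> \<phi> t \<otimes> \<phi> h))
      has_real_derivative field_bracket Y X (\<lambda>y. f (y \<otimes> \<phi> (- t))) (x \<otimes> \<phi> t)) (at 0)"
    using field_bracket_DERIV_0[OF \<phi> Y X smooth_function_right[OF f, of "\<phi> (- t)"], of "x \<otimes> \<phi> t"] by simp
  moreover have "X (\<lambda>y. f (y \<otimes> \<phi> (- h) \<otimes> \<phi> (- t))) (x \<otimes> \<phi> t \<otimes> \<phi> h) = Ad G (\<phi> (t + h)) X f x" for h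
    by (simp add: Ad_left_invariant[OF X f] phi(4) assoc phi(2)[symmetric] add.commute)
  ultimately have "((\<lambda>h. Ad G (\<phi> (t + h)) X f x) has_real_derivative Ad G (\<phi> t) (field_bracket Y X) f x) (at 0)"
    by (simp add: Ad_left_invariant[OF field_bracket_lie_algebra[OF Y X] f] phi(4))
  then show ?thesis using DERIV_shift[of "\<lambda>h. Ad G (\<phi> h) X f x" _ 0 t] by (simp add: add.commute)
qed

lemma Ad_0: 
  assumes "one_parameter_subgroup G A Y \<phi>" "Y \<in> lie_algebra G A" 
  shows "Ad G (\<phi> 0) X = X"
  using one_parameter_subgroupD(3)[OF assms] by (simp add: Ad_def)

lemma lie_algebra_eq_0I:
  assumes "X \<in> lie_algebra G A" "\<And>f x. f \<in> smooth_functions A \<Longrightarrow> X f x = 0"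
  shows "X = 0"
proof
  fix f show "X f = 0 f"
    using assms(2) derivation_nonsmooth[OF lie_algebraD(1)[OF assms(1)]]
    by (cases "f \<in> smooth_functions A") (auto simp: fun_eq_iff)
qed

text \<open>The curve \<open>Ad G (\<phi> t) X\<close> is constant here, and its derivative at 0 is
  the bracket.\<close>

lemma field_bracket_eq_0_if_centralizes:
  assumes "centralizes G K H" "X \<in> H" "X \<in> lie_algebra G A" "Y \<in> subgroup_lie_algebra G A K"
  shows "field_bracket Y X = 0"
proof -
  obtain \<phi> where \<phi>: "one_parameter_subgroup G A Y \<phi>" "range \<phi> \<subseteq> K" and Y: "Y \<in> lie_algebra G A"
    using assms(4) by (auto simp: subgroup_lie_algebra_def)
  have "Ad G (\<phi> t) X = X" for t using assms(1,2) \<phi>(2) by (auto simp: centralizes_def)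
  then have "((\<lambda>t. X f x) has_real_derivative field_bracket Y X f x) (at 0)" if "f \<in> smooth_functions A" for f x
    using Ad_DERIV[OF \<phi>(1) Y assms(3) that, of x 0] by (simp add: Ad_0[OF \<phi>(1) Y])
  then show ?thesis
    by (intro lie_algebra_eq_0I field_bracket_lie_algebra Y assms(3)) (blast intro: DERIV_unique DERIV_const)
qed

text \<open>If \<open>[Y, [Y, X]] = 0\<close>, then \<open>Ad (exp (t Y)) X = X + t [Y, X]\<close> stays bounded.\<close>

lemma field_bracket_eq_0_if_compact:
  assumes K: "compact K" and "Y \<in> subgroup_lie_algebra G A K" and X: "X \<in> lie_algebra G A"
    and YYX: "field_bracket Y (field_bracket Y X) = 0"
  shows "field_bracket Y X = 0"
proof -
  obtain \<phi> where \<phi>: "one_parameter_subgroup G A Y \<phi>" "range \<phi> \<subseteq> K" and Y: "Y \<in> lie_algebra G A"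
    using assms(2) by (auto simp: subgroup_lie_algebra_def)
  let ?Z = "field_bracket Y X"
  have Z: "?Z \<in> lie_algebra G A" by (rule field_bracket_lie_algebra[OF Y X])
  have "?Z f x = 0" if f: "f \<in> smooth_functions A" for f x
  proof -
    \<comment> \<open>The derivative of this curve is the adjoint image of
      \<open>[Y, [Y, X]] = 0\<close>, so the curve keeps its value at time 0.\<close>
    have "Ad G (\<phi> t) ?Z f x = ?Z f x" for t
    proof -
      have "((\<lambda>t. Ad G (\<phi> t) ?Z f x) has_real_derivative 0) (at t)" for t
        using Ad_DERIV[OF \<phi>(1) Y Z f, of x t] YYX by (simp add: Ad_def)
      then have "Ad G (\<phi> t) ?Z f x = Ad G (\<phi> 0) ?Z f x" using DERIV_isconst_all by blast
      then show ?thesis by (simp add: Ad_0[OF \<phi>(1) Y])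
    qed
    then have d: "((\<lambda>t. Ad G (\<phi> t) X f x) has_real_derivative ?Z f x) (at t)" for t
      using Ad_DERIV[OF \<phi>(1) Y X f, of x t] by simp
    have "((\<lambda>t. Ad G (\<phi> t) X f x - t * ?Z f x) has_real_derivative 0) (at t)" for t
      using DERIV_diff[OF d DERIV_cmult_right[OF DERIV_ident, of "?Z f x"]] by simp
    then have aff: "Ad G (\<phi> t) X f x - t * ?Z f x = Ad G (\<phi> 0) X f x - 0 * ?Z f x" for t
      by (intro DERIV_isconst_all) blast
    obtain M where M: "\<forall>k\<in>K. \<bar>Ad G k X f x\<bar> \<le> M" using Ad_bounded[OF X f K] by blast
    then have b: "\<bar>Ad G (\<phi> t) X f x\<bar> \<le> M" for t using \<phi>(2) by auto
    show "?Z f x = 0"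
    proof (rule ccontr)
      assume nz: "?Z f x \<noteq> 0"
      \<comment> \<open>At this time the linear term equals \<open>2 * M + 1\<close>, while two
        values bounded by \<open>M\<close> differ by at most \<open>2 * M\<close>.\<close>
      let ?t = "(2 * M + 1) / ?Z f x"
      have "?t * ?Z f x = 2 * M + 1" using nz by simp
      then show False using b[of ?t] b[of 0] aff[of ?t] by linarith
    qed
  qed
  then show ?thesis by (rule lie_algebra_eq_0I[OF Z])
qed

end

section \<open>Cartan subalgebras\<close>

lemma direct_sum2:
  assumes "direct_sum [M, R] W"
  shows "subspace M" "subspace R" "M \<subseteq> W" "R \<subseteq> W" "w \<in> W \<Longrightarrow> \<exists>m\<in>M. \<exists>r\<in>R. w = m + r" "M \<inter> R = {0}"
proof -
  show s: "subspace M" "subspace R" using assms by (auto simp: direct_sum_def)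
  have inj: "inj_on sum_list (listset [M, R])" and im: "sum_list ` listset [M, R] = W"
    using assms by (auto simp: direct_sum_def bij_betw_def)
  have in_W: "m + r \<in> W" if "m \<in> M" "r \<in> R" for m r
  proof -
    have "sum_list [m, r] \<in> W" unfolding im[symmetric]
      using that by (intro imageI) (simp add: set_Cons_def)
    then show ?thesis by simp
  qed
  then show "M \<subseteq> W" "R \<subseteq> W"
    using in_W[of _ 0] in_W[of 0] subspace_0[OF s(1)] subspace_0[OF s(2)] by auto
  show "\<exists>m\<in>M. \<exists>r\<in>R. w = m + r" if "w \<in> W"
    using that unfolding im[symmetric] by (force simp: set_Cons_def)
  show "M \<inter> R = {0}"
  proof (intro equalityI subsetI)
    fix x assume x: "x \<in> M \<inter> R"
    have "[x, - x] = [0, 0]"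
      by (rule inj_onD[OF inj])
        (use x subspace_neg[OF s(2)] subspace_0[OF s(1)] subspace_0[OF s(2)] in \<open>auto simp: set_Cons_def\<close>)
    then show "x \<in> {0}" by simp
  qed (simp add: subspace_0 s)
qed

lemma direct_sum4:
  assumes "direct_sum [U, S, K, H] W"
  shows "subspace U" "subspace S" "subspace K" "subspace H"
    "w \<in> W \<Longrightarrow> \<exists>u\<in>U. \<exists>s\<in>S. \<exists>k\<in>K. \<exists>h\<in>H. w = u + s + k + h"
    "u \<in> U \<Longrightarrow> s \<in> S \<Longrightarrow> k \<in> K \<Longrightarrow> h \<in> H \<Longrightarrow> u + s + k + h \<in> W"
    "u \<in> U \<Longrightarrow> s \<in> S \<Longrightarrow> k \<in> K \<Longrightarrow> h \<in> H \<Longrightarrow> u + s + k + h = 0 \<Longrightarrow> u = 0 \<and> s = 0 \<and> k = 0 \<and> h = 0"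
proof -
  show s: "subspace U" "subspace S" "subspace K" "subspace H" using assms by (auto simp: direct_sum_def)
  have inj: "inj_on sum_list (listset [U, S, K, H])" and im: "sum_list ` listset [U, S, K, H] = W"
    using assms by (auto simp: direct_sum_def bij_betw_def)
  show "\<exists>u\<in>U. \<exists>s\<in>S. \<exists>k\<in>K. \<exists>h\<in>H. w = u + s + k + h" if w: "w \<in> W"
  proof -
    obtain u s k h where "u \<in> U" "s \<in> S" "k \<in> K" "h \<in> H" "w = sum_list [u, s, k, h]"
      using w unfolding im[symmetric] by (auto simp: set_Cons_def)
    moreover from this have "w = u + s + k + h" by (simp add: add.assoc)
    ultimately show ?thesis by blast
  qed
  show "u + s + k + h \<in> W" if *: "u \<in> U" "s \<in> S" "k \<in> K" "h \<in> H"
  proof -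
    have "sum_list [u, s, k, h] \<in> W" unfolding im[symmetric]
      using * by (intro imageI) (simp add: set_Cons_def)
    then show ?thesis by (simp add: add.assoc)
  qed
  show "u = 0 \<and> s = 0 \<and> k = 0 \<and> h = 0"
    if *: "u \<in> U" "s \<in> S" "k \<in> K" "h \<in> H" "u + s + k + h = 0"
  proof -
    have "[u, s, k, h] = [0, 0, 0, 0]"
      by (rule inj_onD[OF inj])
        (use * subspace_0[OF s(1)] subspace_0[OF s(2)] subspace_0[OF s(3)] subspace_0[OF s(4)]
          in \<open>auto simp: set_Cons_def add.assoc\<close>)
    then show ?thesis by simp
  qed
qed

lemma direct_sum3I:
  assumes s: "subspace M" "subspace N" "subspace R"
    and ind: "\<And>m n r. m \<in> M \<Longrightarrow> n \<in> N \<Longrightarrow> r \<in> R \<Longrightarrow> m + n + r = 0 \<Longrightarrow> m = 0 \<and> n = 0 \<and> r = 0"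
  shows "direct_sum [M, N, R] {m + n + r | m n r. m \<in> M \<and> n \<in> N \<and> r \<in> R}"
proof -
  have "inj_on sum_list (listset [M, N, R])"
  proof (rule inj_onI)
    fix xs ys assume "xs \<in> listset [M, N, R]" "ys \<in> listset [M, N, R]" and eq: "sum_list xs = sum_list ys"
    then obtain m n r m' n' r' where *: "xs = [m, n, r]" "ys = [m', n', r']"
      "m \<in> M" "n \<in> N" "r \<in> R" "m' \<in> M" "n' \<in> N" "r' \<in> R"
      by (auto simp: set_Cons_def)
    have "(m - m') + (n - n') + (r - r') = 0"
      using eq * by (simp add: algebra_simps)
    then have "m - m' = 0 \<and> n - n' = 0 \<and> r - r' = 0"
      using * s by (intro ind subspace_diff) auto
    then show "xs = ys" using * by simp
  qed
  moreover have "sum_list ` listset [M, N, R] = {m + n + r | m n r. m \<in> M \<and> n \<in> N \<and> r \<in> R}" (is "?L = ?R")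
  proof (intro equalityI subsetI)
    fix x assume "x \<in> ?L"
    then obtain m n r where "m \<in> M" "n \<in> N" "r \<in> R" "x = m + n + r"
      by (auto simp: set_Cons_def add.assoc)
    then show "x \<in> ?R" by blast
  next
    fix x assume "x \<in> ?R"
    then obtain m n r where *: "m \<in> M" "n \<in> N" "r \<in> R" "x = m + n + r" by blast
    then have "x = sum_list [m, n, r]" "[m, n, r] \<in> listset [M, N, R]"
      by (auto simp: set_Cons_def add.assoc)
    then show "x \<in> ?L" by blast
  qed
  ultimately show ?thesis using s by (auto simp: direct_sum_def bij_betw_def)
qed

section \<open>Abstract Lie algebras and the Cartan criterion\<close>

text \<open>\<open>anticomm\<close> ranges over all vectors, since \<open>field_bracket\<close> is
  antisymmetric by its form. Linearity is confined to \<open>L\<close> because it uses that the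
  operators are additive and homogeneous on smooth functions. Linearity on the left follows by
  antisymmetry.\<close>

locale real_lie_algebra =
  fixes br :: "'v \<Rightarrow> 'v \<Rightarrow> 'v::real_vector" and L :: "'v set"
  assumes subspace: "subspace L"
    and closed: "x \<in> L \<Longrightarrow> y \<in> L \<Longrightarrow> br x y \<in> L"
    and add_right: "x \<in> L \<Longrightarrow> y \<in> L \<Longrightarrow> z \<in> L \<Longrightarrow> br x (y + z) = br x y + br x z"
    and scale_right: "x \<in> L \<Longrightarrow> y \<in> L \<Longrightarrow> br x (r *\<^sub>R y) = r *\<^sub>R br x y"
    and anticomm: "br x y = - br y x"
begin

lemma add_left: "x \<in> L \<Longrightarrow> y \<in> L \<Longrightarrow> z \<in> L \<Longrightarrow> br (x + y) z = br x z + br y z"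
  using anticomm[of "x + y" z] anticomm[of x z] anticomm[of y z] add_right[of z x y] by simp

lemma scale_left: "x \<in> L \<Longrightarrow> y \<in> L \<Longrightarrow> br (r *\<^sub>R x) y = r *\<^sub>R br x y"
  using anticomm[of "r *\<^sub>R x" y] anticomm[of x y] scale_right[of y x r] by simp

lemma self [simp]: "br x x = 0"
proof -
  have "br x x + br x x = 0" using anticomm[of x x] by (metis add.right_inverse)
  then have "2 *\<^sub>R br x x = 0" by (simp add: scaleR_2)
  then show ?thesis by simp
qed

lemma zero_right: "x \<in> L \<Longrightarrow> br x 0 = 0"
  using scale_right[of x 0 0] subspace_0[OF subspace] by simp

text \<open>Elements of the subalgebra \<open>K\<close> behave as if \<open>ad\<close> were semisimple on them. This replaces the
  invariant inner product in the usual proof that compact Lie algebras are reductive.\<close>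

lemma solvable_ideal_central:
  assumes K: "K \<subseteq> L"
    and ss: "\<And>x y. y \<in> K \<Longrightarrow> x \<in> K \<Longrightarrow> br y (br y x) = 0 \<Longrightarrow> br y x = 0"
    and I: "lie_ideal br K I" "lie_solvable br I"
  shows "y \<in> I \<Longrightarrow> x \<in> K \<Longrightarrow> br y x = 0"
proof -
  let ?D = "derived_series br I"
  have subI: "subspace I" "I \<subseteq> K" using I(1) by (auto simp: lie_ideal_def)
  have in_D: "br x y \<in> ?D (Suc n)" if "x \<in> ?D n" "y \<in> ?D n" for x y n
    using that by (auto simp: bracket_span_def intro!: span_base)
  have decr: "?D (Suc n) \<subseteq> ?D n" for n
  proof (induction n)
    case 0
    have "{br x y |x y. x \<in> I \<and> y \<in> I} \<subseteq> I" using I(1) by (auto simp: lie_ideal_def)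
    then show ?case using subI(1) by (simp add: bracket_span_def span_minimal)
  next
    case (Suc n)
    have "bracket_span br (?D (Suc n)) (?D (Suc n)) \<subseteq> bracket_span br (?D n) (?D n)"
      unfolding bracket_span_def by (rule span_mono) (use Suc in blast)
    then show ?case by simp
  qed
  have D_I: "?D n \<subseteq> I" for n
  proof (induction n)
    case (Suc n)
    then show ?case using decr[of n] by blast
  qed simp
  \<comment> \<open>Descent along the derived series. For \<open>y = [a, b]\<close> with
    \<open>a\<close>, \<open>b\<close> in stage \<open>n\<close>, the bracket
    \<open>[y, [y, a]]\<close> lies in stage \<open>n + 2\<close> and vanishes, so
    \<open>[y, a] = 0\<close>. This says \<open>[a, [a, b]] = 0\<close>, and hence
    \<open>[a, b] = 0\<close>. Repetition ends with an abelian \<open>I\<close>.\<close>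
  have step: "?D (Suc n) \<subseteq> {0}" if "?D (Suc (Suc n)) \<subseteq> {0}" for n
  proof -
    have "br a b = 0" if ab: "a \<in> ?D n" "b \<in> ?D n" for a b
    proof -
      have y: "br a b \<in> ?D (Suc n)" by (rule in_D[OF ab])
      have aK: "a \<in> K" "b \<in> K" "br a b \<in> K" using ab y D_I subI by blast+
      have "br (br a b) a \<in> ?D (Suc n)" using y decr ab by (intro in_D) auto
      then have "br (br a b) (br (br a b) a) = 0"
        using in_D[OF y] \<open>?D (Suc (Suc n)) \<subseteq> {0}\<close> by blast
      then have "br (br a b) a = 0" using ss aK by blast
      then have "br a (br a b) = 0" using anticomm[of a "br a b"] by simp
      then show ?thesis using ss aK by blast
    qed
    then have "{br x y |x y. x \<in> ?D n \<and> y \<in> ?D n} \<subseteq> {0}" by auto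
    then show ?thesis unfolding derived_series.simps bracket_span_def
      by (rule span_minimal) (rule subspace_single_0)
  qed
  obtain n where "?D n = {0}" using I(2) by (auto simp: lie_solvable_def)
  then have "?D (Suc n) \<subseteq> {0}" using decr[of n] by simp
  then have "?D (Suc 0) \<subseteq> {0}" by (induction n) (auto dest: step simp del: derived_series.simps)
  then have ab: "br x y = 0" if "x \<in> I" "y \<in> I" for x y using in_D[of x 0 y] that by auto
  show "br y x = 0" if yx: "y \<in> I" "x \<in> K"
  proof (rule ss)
    \<comment> \<open>The bracket of \<open>y\<close> with any \<open>x\<close> in \<open>K\<close>
      stays in the abelian ideal, so bracketing once more with \<open>y\<close> gives 0.\<close>
    have "br x y \<in> I" using I(1) yx by (simp add: lie_ideal_def)
    then have "br y x \<in> I" using anticomm[of y x] subspace_neg[OF subI(1)] by simp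
    then show "br y (br y x) = 0" using ab yx by blast
  qed (use yx subI in auto)
qed

text \<open>For \<open>a\<close> in \<open>a0\<close> the bracket \<open>[m, a]\<close> lies in the
  abelian \<open>a0\<close>, so \<open>[a, [a, m]] = 0\<close> and then \<open>[a, m] = 0\<close>.
  Thus \<open>m\<close> commutes with \<open>a0\<close> and can be adjoined to it, which maximality
  permits only if \<open>m\<close> is already there.\<close>

lemma normalizer_maximal_abelian:
  assumes M: "lie_subalgebra br L M"
    and ss: "\<And>x y. y \<in> M \<Longrightarrow> x \<in> M \<Longrightarrow> br y (br y x) = 0 \<Longrightarrow> br y x = 0"
    and a0: "maximal_abelian_subalgebra br M a0"
    and m: "m \<in> M" "\<And>a. a \<in> a0 \<Longrightarrow> br m a \<in> a0"
  shows "m \<in> a0"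
proof -
  have a0_ab: "abelian_subalgebra br M a0" using a0 by (simp add: maximal_abelian_subalgebra_def)
  then have sa: "subspace a0" "a0 \<subseteq> M" "\<And>x y. x \<in> a0 \<Longrightarrow> y \<in> a0 \<Longrightarrow> br x y = 0"
    by (auto simp: abelian_subalgebra_def lie_subalgebra_def)
  have sM: "subspace M" "M \<subseteq> L" using M by (auto simp: lie_subalgebra_def)
  have am: "br a m = 0" if a: "a \<in> a0" for a
  proof (rule ss)
    have "br a (br m a) = 0" using a m sa by blast
    moreover have "a \<in> L" "br m a \<in> L" using a sa(2) sM(2) m(1) closed by blast+
    then have "br a (br a m) = - br a (br m a)"
      using scale_right[of a "br m a" "-1"] anticomm[of a m] by simp
    ultimately show "br a (br a m) = 0" by simp
  qed (use a m sa in auto)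
  define N where "N = {a + r *\<^sub>R m | a r. a \<in> a0}"
  have N_eq: "N = {x + y | x y. x \<in> a0 \<and> y \<in> span {m}}"
    unfolding N_def span_singleton by blast
  have "subspace N" unfolding N_eq by (intro subspace_sums sa subspace_span)
  moreover have "N \<subseteq> M"
    unfolding N_def using sa sM m by (auto intro!: subspace_add subspace_scale)
  moreover have "br x y = 0" if xy: "x \<in> N" "y \<in> N" for x y
  proof -
    obtain a r b s where *: "a \<in> a0" "b \<in> a0" "x = a + r *\<^sub>R m" "y = b + s *\<^sub>R m"
      using xy by (auto simp: N_def)
    have abm: "a \<in> L" "b \<in> L" "m \<in> L" using * sa sM m by blast+
    then have rs: "r *\<^sub>R m \<in> L" "s *\<^sub>R m \<in> L" by (auto intro: subspace_scale[OF subspace])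
    then have "x \<in> L" unfolding *(3) using abm by (intro subspace_add[OF subspace])
    note in_L = abm rs this
    have "br m b = 0" using am[OF *(2)] anticomm[of m b] by simp
    then have "br x b = 0" "br x m = 0"
      using in_L *(3) sa(3)[OF *(1,2)] am[OF *(1)] by (simp_all add: add_left scale_left)
    then show ?thesis using *(4) in_L by (simp add: add_right scale_right)
  qed
  ultimately have "abelian_subalgebra br M N"
    using subspace_0 by (auto simp: abelian_subalgebra_def lie_subalgebra_def)
  moreover have "a0 \<subseteq> N"
  proof
    fix a assume "a \<in> a0"
    then show "a \<in> N" unfolding N_def by (intro CollectI exI[of _ a] exI[of _ 0]) simp
  qed
  ultimately have "N = a0" using a0 by (auto simp: maximal_abelian_subalgebra_def)
  moreover have "m \<in> N" unfolding N_def
    using subspace_0[OF sa(1)] by (intro CollectI exI[of _ 0] exI[of _ 1]) simp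
  ultimately show ?thesis by simp
qed

text \<open>The summands from \<open>Z\<close> drop out of every bracket, so brackets in
  \<open>C\<close> are brackets in \<open>H\<close>.\<close>

lemma nilpotent_add_central:
  assumes H: "lie_subalgebra br L H" "lie_nilpotent br H"
    and Z: "Z \<subseteq> L" "\<And>x y. x \<in> Z \<Longrightarrow> y \<in> Z \<Longrightarrow> br x y = 0" "\<And>x y. x \<in> Z \<Longrightarrow> y \<in> H \<Longrightarrow> br x y = 0"
    and C: "C \<subseteq> {h + z | h z. h \<in> H \<and> z \<in> Z}" "0 \<in> C"
  shows "lie_nilpotent br C"
proof -
  have sH: "subspace H" "H \<subseteq> L" "\<And>x y. x \<in> H \<Longrightarrow> y \<in> H \<Longrightarrow> br x y \<in> H"
    using H(1) by (auto simp: lie_subalgebra_def)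
  have HZ: "br y x = 0" if "x \<in> Z" "y \<in> H" for x y using Z(3)[OF that] anticomm[of y x] by simp
  have br: "br (h + z) (h' + z') = br h h'" if "h \<in> H" "h' \<in> H" "z \<in> Z" "z' \<in> Z" for h h' z z'
  proof -
    have "h \<in> L" "h' \<in> L" "z \<in> L" "z' \<in> L" using that sH Z by blast+
    then show ?thesis
      using that by (simp add: add_left add_right subspace_add[OF subspace] Z(2,3) HZ)
  qed
  have lH: "lower_central br H n \<subseteq> H" for n
  proof (induction n)
    case (Suc n)
    then have "{br x y |x y. x \<in> H \<and> y \<in> lower_central br H n} \<subseteq> H" using sH by blast
    then show ?case using sH(1) by (simp add: bracket_span_def span_minimal)
  qed simp
  \<comment> \<open>The comparison starts at stage 1, since \<open>C\<close> itself need not lie in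
    \<open>H\<close>.\<close>
  have sub: "lower_central br C (Suc n) \<subseteq> lower_central br H (Suc n)" for n
  proof (induction n)
    case 0
    have "{br x y |x y. x \<in> C \<and> y \<in> C} \<subseteq> {br x y |x y. x \<in> H \<and> y \<in> H}"
    proof
      fix w assume "w \<in> {br x y |x y. x \<in> C \<and> y \<in> C}"
      then obtain h z h' z' where "h \<in> H" "h' \<in> H" "z \<in> Z" "z' \<in> Z" "w = br (h + z) (h' + z')"
        using C(1) by blast
      then show "w \<in> {br x y |x y. x \<in> H \<and> y \<in> H}" using br by blast
    qed
    then show ?case by (simp add: bracket_span_def span_mono)
  next
    case (Suc n)
    have "{br x y |x y. x \<in> C \<and> y \<in> lower_central br C (Suc n)} \<subseteq>
        {br x y |x y. x \<in> H \<and> y \<in> lower_central br H (Suc n)}"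
    proof
      fix w assume "w \<in> {br x y |x y. x \<in> C \<and> y \<in> lower_central br C (Suc n)}"
      then obtain h z y where *: "h \<in> H" "z \<in> Z" "y \<in> lower_central br H (Suc n)" "w = br (h + z) y"
        using C(1) Suc by blast
      then have "y \<in> H" using lH by blast
      then have "w = br h y" using * Z(3) add_left[of h z y] sH(2) Z(1) by auto
      then show "w \<in> {br x y |x y. x \<in> H \<and> y \<in> lower_central br H (Suc n)}" using * by blast
    qed
    then show ?case
      unfolding lower_central.simps(2)[of br C "Suc n"] lower_central.simps(2)[of br H "Suc n"] bracket_span_def
      by (rule span_mono)
  qed
  obtain n where n: "lower_central br H n = {0}" using H(2) by (auto simp: lie_nilpotent_def)
  have "{br x y |x y. x \<in> H \<and> y \<in> {0}} \<subseteq> {0}" using zero_right sH(2) by auto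
  then have "span {br x y |x y. x \<in> H \<and> y \<in> {0}} \<subseteq> {0}" by (rule span_minimal) (rule subspace_single_0)
  then have "lower_central br H (Suc n) \<subseteq> {0}"
    unfolding lower_central.simps n bracket_span_def .
  then have "lower_central br C (Suc n) = {0}"
    using sub[of n] span_zero by (auto simp: bracket_span_def)
  then show ?thesis unfolding lie_nilpotent_def by blast
qed

text \<open>The candidate lies in \<open>K + H\<close>, so bracketing a normalizing element with
  \<open>h0\<close> leaves no part in \<open>U\<close> or \<open>S\<close>. Of the rest, the parts
  in \<open>H\<close> and in \<open>T\<close> belong to the candidate, and its action on
  \<open>a0\<close> shows that the part in \<open>M\<close> normalizes \<open>a0\<close>.\<close>

lemma cartan_subalgebra_of_hyperbolic_splitting:
  assumes H: "lie_subalgebra br L H" "lie_nilpotent br H"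
    and HK: "H \<inter> K = {0}"
    and comm: "\<And>x y. y \<in> K \<Longrightarrow> x \<in> H \<Longrightarrow> br y x = 0"
    and ss: "\<And>x y. y \<in> K \<Longrightarrow> x \<in> K \<Longrightarrow> br y (br y x) = 0 \<Longrightarrow> br y x = 0"
    and levi: "levi_decomposition br K M T"
    and a0: "maximal_abelian_subalgebra br M a0"
    and h0: "h0 \<in> H"
    and split: "direct_sum [U, S, K, H] L" "\<And>V. V \<in> {U, S, K, H} \<Longrightarrow> br h0 ` V \<subseteq> V"
    and ev: "\<not> complex_eigenvalue_on U (br h0) 0" "\<not> complex_eigenvalue_on S (br h0) 0"
  shows "direct_sum [H, a0, T] {h + a + t | h a t. h \<in> H \<and> a \<in> a0 \<and> t \<in> T} \<and>
    cartan_subalgebra br L {h + a + t | h a t. h \<in> H \<and> a \<in> a0 \<and> t \<in> T}"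
proof -
  define C where "C = {h + a + t | h a t. h \<in> H \<and> a \<in> a0 \<and> t \<in> T}"
  note sp = direct_sum4[OF split(1)]
  have sub: "U \<subseteq> L" "S \<subseteq> L" "K \<subseteq> L" "H \<subseteq> L"
    using sp(6)[of _ 0 0 0] sp(6)[of 0 _ 0 0] sp(6)[of 0 0 _ 0] sp(6)[of 0 0 0] sp(1-4)[THEN subspace_0]
    by auto
  have sH: "\<And>x y. x \<in> H \<Longrightarrow> y \<in> H \<Longrightarrow> br x y \<in> H" using H(1) by (auto simp: lie_subalgebra_def)
  have ds: "direct_sum [M, T] K" and rad: "lie_ideal br K T" "lie_solvable br T" and M: "lie_subalgebra br K M"
    using levi by (auto simp: levi_decomposition_def is_radical_def)
  note MT = direct_sum2[OF ds]
  have M_L: "lie_subalgebra br L M" using M sub(3) by (auto simp: lie_subalgebra_def)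
  have T0: "br y x = 0" if "y \<in> T" "x \<in> K" for x y
    using solvable_ideal_central[OF sub(3) ss rad] that by blast
  have a0': "subspace a0" "a0 \<subseteq> M" "\<And>x y. x \<in> a0 \<Longrightarrow> y \<in> a0 \<Longrightarrow> br x y = 0"
    using a0 by (auto simp: maximal_abelian_subalgebra_def abelian_subalgebra_def lie_subalgebra_def)
  have aK: "a0 \<subseteq> K" using a0'(2) MT(3) by blast
  have ind: "h = 0 \<and> a = 0 \<and> t = 0" if hat: "h \<in> H" "a \<in> a0" "t \<in> T" "h + a + t = 0" for h a t
  proof -
    have "h = - (a + t)" using hat(4) by (metis add.assoc eq_neg_iff_add_eq_0)
    moreover have "- (a + t) \<in> K" using hat aK MT(4) sp(3) by (intro subspace_neg subspace_add) auto
    ultimately have "h \<in> K" by (simp only:)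
    then have "h = 0" using hat(1) HK by blast
    then have "a = - t" using hat(4) by (simp add: eq_neg_iff_add_eq_0)
    then have "a \<in> M \<inter> T" using hat a0'(2) subspace_neg[OF MT(2)] by auto
    then have "a = 0" using MT(6) by auto
    with \<open>h = 0\<close> \<open>a = - t\<close> show ?thesis by simp
  qed
  \<comment> \<open>The part of the candidate inside \<open>K\<close>: abelian because
    \<open>T\<close> is central in \<open>K\<close>, and commuting with \<open>H\<close>.\<close>
  define Z where "Z = {a + t | a t. a \<in> a0 \<and> t \<in> T}"
  have ZK: "Z \<subseteq> K" unfolding Z_def using aK MT(4) sp(3) by (auto intro!: subspace_add)
  have sZ: "subspace Z" unfolding Z_def by (rule subspace_sums[OF a0'(1) MT(2)])
  have C_eq: "C = {h + z | h z. h \<in> H \<and> z \<in> Z}"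
    unfolding C_def Z_def by (auto simp: add.assoc)
  have sC: "subspace C" unfolding C_eq by (rule subspace_sums[OF sp(4) sZ])
  have Z0: "br x y = 0" if xy: "x \<in> Z" "y \<in> Z" for x y
  proof -
    obtain a t where at: "a \<in> a0" "t \<in> T" "x = a + t" using xy by (auto simp: Z_def)
    obtain b s where bs: "b \<in> a0" "s \<in> T" "y = b + s" using xy by (auto simp: Z_def)
    have in_K: "a \<in> K" "t \<in> K" "b \<in> K" "s \<in> K" "y \<in> K" using at bs xy aK MT(4) ZK by blast+
    have "br a s = 0" using T0[of s a] anticomm[of a s] in_K bs by simp
    then have "br a y = 0" using bs in_K sub(3) at a0'(3) by (auto simp: add_right subset_iff)
    then show ?thesis using at in_K sub(3) T0[of t y] add_left[of a t y] by auto
  qed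
  have HC: "H \<subseteq> C" "Z \<subseteq> C"
    unfolding C_eq using subspace_0[OF sZ] subspace_0[OF sp(4)] by force+
  have brC: "br x y \<in> C" if xy: "x \<in> C" "y \<in> C" for x y
  proof -
    obtain h z h' z' where *: "h \<in> H" "h' \<in> H" "z \<in> Z" "z' \<in> Z" "x = h + z" "y = h' + z'"
      using xy unfolding C_eq by blast
    have in_L: "h \<in> L" "z \<in> L" "h' \<in> L" "z' \<in> L" using * sub ZK by blast+
    have "br z h' = 0" "br z' h = 0" using comm * ZK by blast+
    then have "br x y = br h h'"
      using * in_L Z0 anticomm[of h z'] by (simp add: add_left add_right subspace_add[OF subspace])
    then show ?thesis using * sH HC by auto
  qed
  have CL: "C \<subseteq> L" unfolding C_eq using sub ZK subspace by (auto intro!: subspace_add)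
  have C_sub: "lie_subalgebra br L C" using sC CL brC by (simp add: lie_subalgebra_def)
  have "lie_nilpotent br C"
    by (rule nilpotent_add_central[OF H, of Z])
      (use ZK sub(3) Z0 comm C_eq subspace_0[OF sC] in auto)
  moreover have "lie_normalizer br L C = C"
  proof (intro equalityI subsetI)
    fix x assume "x \<in> C"
    then show "x \<in> lie_normalizer br L C" using CL brC by (auto simp: lie_normalizer_def)
  next
    fix x assume "x \<in> lie_normalizer br L C"
    then have x: "x \<in> L" "\<And>y. y \<in> C \<Longrightarrow> br x y \<in> C" by (auto simp: lie_normalizer_def)
    obtain u s k h where d: "u \<in> U" "s \<in> S" "k \<in> K" "h \<in> H" "x = u + s + k + h"
      using sp(5)[OF x(1)] by blast
    have in_L: "u \<in> L" "s \<in> L" "k \<in> L" "h \<in> L" "h0 \<in> L" using d sub h0 by blast+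
    have "br h0 x \<in> C" using x(2)[of h0] h0 HC anticomm[of h0 x] subspace_neg[OF sC] by auto
    then obtain h' z where hz: "h' \<in> H" "z \<in> Z" "br h0 x = h' + z" unfolding C_eq by blast
    have "br h0 x = br h0 u + br h0 s + br h0 k + br h0 h"
      using in_L d(5) by (simp add: add_right subspace_add[OF subspace])
    with hz have "br h0 u + br h0 s + (br h0 k - z) + (br h0 h - h') = 0" by (simp add: algebra_simps)
    moreover have "br h0 u \<in> U" "br h0 s \<in> S" "br h0 k \<in> K" "br h0 h \<in> H"
      using split(2)[of U] split(2)[of S] split(2)[of K] split(2)[of H] d by blast+
    moreover from this have "br h0 k - z \<in> K" "br h0 h - h' \<in> H"
      using hz ZK sp(3,4) by (blast intro: subspace_diff)+
    ultimately have "br h0 u = 0" "br h0 s = 0" using sp(7) by blast+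
    \<comment> \<open>A nonzero \<open>u\<close> or \<open>s\<close> killed by \<open>br h0\<close>
      would be an eigenvector for 0, with imaginary part 0.\<close>
    then have us: "u = 0" "s = 0"
      using ev d subspace_0[OF sp(1)] subspace_0[OF sp(2)] zero_right[OF in_L(5)]
      by (auto simp: complex_eigenvalue_on_def)
    obtain m t where mt: "m \<in> M" "t \<in> T" "k = m + t" using MT(5) d(3) by blast
    have "m \<in> a0"
    proof (rule normalizer_maximal_abelian[OF M_L _ a0 mt(1)])
      show "br y x = 0" if "y \<in> M" "x \<in> M" "br y (br y x) = 0" for x y
        using that MT(3) ss by blast
      fix a assume a: "a \<in> a0"
      have aL: "a \<in> L" "m \<in> L" "t \<in> L" "a \<in> K" "m \<in> K" using a aK sub(3) mt MT(3,4) by blast+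
      have "br h a = 0" using comm[of a h] a aK d(4) anticomm[of h a] by auto
      moreover have "br t a = 0" using T0 mt a aK by blast
      \<comment> \<open>Both \<open>h\<close> and the central part \<open>t\<close> commute with
        \<open>a\<close>, so only \<open>m\<close> contributes.\<close>
      ultimately have "br x a = br m a"
        using d(5) us mt(3) aL in_L by (simp add: add_left subspace_add[OF subspace])
      moreover have "a \<in> C" using a HC(2) subspace_0[OF MT(2)] unfolding Z_def by force
      ultimately have "br m a \<in> C" using x(2) by metis
      then obtain h' b r where *: "h' \<in> H" "b \<in> a0" "r \<in> T" "br m a = h' + b + r"
        unfolding C_def by blast
      have mM: "br m a \<in> M" using M mt(1) a a0'(2) by (auto simp: lie_subalgebra_def)
      \<comment> \<open>Since \<open>br m a\<close> lies in \<open>M\<close>, its components in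
        \<open>H\<close> and \<open>T\<close> fall into \<open>H \<inter> K\<close> and
        \<open>M \<inter> T\<close>, and so vanish one after the other.\<close>
      have "h' = br m a - b - r" using * by simp
      moreover have "br m a - b - r \<in> K"
        using mM * aK MT(3,4) sp(3) by (intro subspace_diff) auto
      ultimately have "h' \<in> K" by (simp only:)
      then have "h' = 0" using *(1) HK by blast
      then have "r = br m a - b" using * by simp
      moreover have "br m a - b \<in> M" using mM * a0'(2) MT(1) by (intro subspace_diff) auto
      ultimately have "r \<in> M" by (simp only:)
      then have "r = 0" using *(3) MT(6) by blast
      with \<open>h' = 0\<close> * show "br m a \<in> a0" by simp
    qed
    then have "x = h + m + t" using d(5) us mt(3) by (simp add: algebra_simps)
    then show "x \<in> C" unfolding C_def using d(4) \<open>m \<in> a0\<close> mt(2) by blast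
  qed
  ultimately have "cartan_subalgebra br L C" using C_sub by (simp add: cartan_subalgebra_def)
  with direct_sum3I[OF sp(4) a0'(1) MT(2) ind] show ?thesis unfolding C_def by blast
qed

end

context lie_group
begin

lemma real_lie_algebra_lie_algebra: "real_lie_algebra field_bracket (lie_algebra G A)"
proof
  have add: "X + Y \<in> lie_algebra G A" if X: "X \<in> lie_algebra G A" and Y: "Y \<in> lie_algebra G A" for X Y
  proof -
    note dX = lie_algebraD(1)[OF X] and dY = lie_algebraD(1)[OF Y]
    have "derivation_field A (X + Y)"
      unfolding derivation_field_def
      by (auto simp: derivation_nonsmooth[OF dX] derivation_nonsmooth[OF dY]
          derivation_add[OF dX] derivation_add[OF dY] derivation_scaleR[OF dX] derivation_scaleR[OF dY]
          derivation_mult[OF dX] derivation_mult[OF dY] derivation_smooth[OF dX] derivation_smooth[OF dY]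
          scaleR_add_right algebra_simps intro!: smooth_function_add)
    then show ?thesis
      using lie_algebraD(2)[OF X] lie_algebraD(2)[OF Y] by (simp add: lie_algebra_def fun_eq_iff)
  qed
  have scale: "r *\<^sub>R X \<in> lie_algebra G A" if X: "X \<in> lie_algebra G A" for X r
  proof -
    note dX = lie_algebraD(1)[OF X]
    have "derivation_field A (r *\<^sub>R X)"
      unfolding derivation_field_def
      by (auto simp: derivation_nonsmooth[OF dX] derivation_add[OF dX] derivation_scaleR[OF dX]
          derivation_mult[OF dX] derivation_smooth[OF dX] scaleR_add_right fun_eq_iff algebra_simps
          intro!: smooth_function_scaleR)
    then show ?thesis
      using lie_algebraD(2)[OF X] by (simp add: lie_algebra_def fun_eq_iff)
  qed
  have "(0 :: ('g \<Rightarrow> real) \<Rightarrow> 'g \<Rightarrow> real) \<in> lie_algebra G A"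
    by (simp add: lie_algebra_def derivation_field_def smooth_function_0 fun_eq_iff)
  then show "subspace (lie_algebra G A)"
    using add scale by (simp add: subspace_def)
  show "field_bracket X Y \<in> lie_algebra G A" if "X \<in> lie_algebra G A" "Y \<in> lie_algebra G A" for X Y
    using that by (rule field_bracket_lie_algebra)
  show "field_bracket X Y = - field_bracket Y X" for X Y :: "('g \<Rightarrow> real) \<Rightarrow> 'g \<Rightarrow> real"
    by (simp add: field_bracket_def fun_eq_iff)
  show "field_bracket X (Y + Z) = field_bracket X Y + field_bracket X Z"
    if "X \<in> lie_algebra G A" "Y \<in> lie_algebra G A" "Z \<in> lie_algebra G A" for X Y Z
    using that[THEN lie_algebraD(1)]
    by (simp add: field_bracket_def fun_eq_iff derivation_add derivation_smooth)
  show "field_bracket X (r *\<^sub>R Y) = r *\<^sub>R field_bracket X Y"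
    if "X \<in> lie_algebra G A" "Y \<in> lie_algebra G A" for X Y r
    using that[THEN lie_algebraD(1)]
    by (simp add: field_bracket_def fun_eq_iff derivation_scaleR derivation_smooth right_diff_distrib)
qed

end

theorem proposition5:
  fixes G :: "'g::{t2_space, second_countable_topology} monoid"
    and A :: "('g, 'e::real_inner) chart set"
    and K \<Gamma> :: "'g set"
    and H Kstar T1 a0 :: "(('g \<Rightarrow> real) \<Rightarrow> 'g \<Rightarrow> real) set"
  assumes "algebraic_anosov_action G A K \<Gamma> H"
    and "connected K"
    and "centralizes G K H"
    and "levi_decomposition field_bracket (subgroup_lie_algebra G A K) Kstar T1"
    and "maximal_abelian_subalgebra field_bracket Kstar a0"
  shows "direct_sum [H, a0, T1] {h + a + t | h a t. h \<in> H \<and> a \<in> a0 \<and> t \<in> T1} \<and>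
    cartan_subalgebra field_bracket (lie_algebra G A)
      {h + a + t | h a t. h \<in> H \<and> a \<in> a0 \<and> t \<in> T1}"
proof -
  let ?k = "subgroup_lie_algebra G A K"
  have action: "lie_group G A" "compact K" "lie_subalgebra field_bracket (lie_algebra G A) H"
    "lie_nilpotent field_bracket H" "H \<inter> ?k = {0}"
    using assms(1) by (auto simp: algebraic_anosov_action_def algebraic_action_def)
  interpret lie_group G A by (rule action(1))
  interpret L: real_lie_algebra field_bracket "lie_algebra G A" by (rule real_lie_algebra_lie_algebra)
  obtain h0 U S where split: "h0 \<in> H" "direct_sum [U, S, ?k, H] (lie_algebra G A)"
      "\<forall>V\<in>{U, S, ?k, H}. field_bracket h0 ` V \<subseteq> V"
    and ev: "\<forall>z. complex_eigenvalue_on U (field_bracket h0) z \<longrightarrow> Re z > 0"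
      "\<forall>z. complex_eigenvalue_on S (field_bracket h0) z \<longrightarrow> Re z < 0"
    using assms(1)[unfolded algebraic_anosov_action_def, THEN conjunct2]
    by (elim bexE exE conjE) (rule that)
  show ?thesis
  proof (rule L.cartan_subalgebra_of_hyperbolic_splitting[OF action(3-5) _ _ assms(4,5) split(1,2) split(3)[rule_format]])
    show "field_bracket Y X = 0" if "Y \<in> ?k" "X \<in> H" for X Y
      using field_bracket_eq_0_if_centralizes[OF assms(3) that(2) _ that(1)] action(3) that(2)
      by (auto simp: lie_subalgebra_def)
    show "field_bracket Y X = 0" if "Y \<in> ?k" "X \<in> ?k" "field_bracket Y (field_bracket Y X) = 0" for X Y
      using field_bracket_eq_0_if_compact[OF action(2) that(1) _ that(3)] that(2)
      by (simp add: subgroup_lie_algebra_def)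
    \<comment> \<open>An eigenvalue 0 has real part 0, which both sign conditions exclude.\<close>
    show "\<not> complex_eigenvalue_on U (field_bracket h0) 0" "\<not> complex_eigenvalue_on S (field_bracket h0) 0"
      using ev[THEN spec[of _ 0]] by auto
  qed
qed

end
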